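(* Let $\Omega=(K,L,q,1,X,\cdot,h,\theta)$ be a quadrangular algebra with $\operatorname{char}(K)\ne2,3$, let $X=X(\Omega,a,\lambda)$ be the structurable algebra with product $\star$ constructed from $\Omega$, and let $$s_0=\frac{N(\lambda)}{2\delta^2}\Bigl(\iota(\lambda)\bigl(a+\tfrac{a\pi(a)}\delta\bigr)-\lambda\bigl(-a+\tfrac{a\pi(a)}\delta\bigr)\Bigr)\in X$$ be its distinguished skew-symmetric element. Then for all $x,y,z\in X$ and $v\in L\setminus\{0\}$, $$(V_{x,\,s_0\star y}\,z)\,v=\frac{V_{xv,\,s_0\star(yv)}\,(zv)}{q(v)}.$$
   Context: **Quadrangular algebras.** A quadrangular algebra of characteristic different from 2 is an 8-tuple $(K,L,q,1,X,\cdot,h,\theta)$ where $K$ is a commutative field with $\operatorname{char}K\ne2$, $L$ is a $K$-vector space, $q:L\to K$ is an anisotropic quadratic form, $1\in L$ satisfies $q(1)=1$, $X$ is a nonzero $K$-vector space, $\cdot:X\times L\to X$, $(a,v)\mapsto av$, $h:X\times X\to L$ and $\theta:X\times L\to L$ are maps such that, with $f(u,v)=q(u+v)-q(u)-q(v)$, $v^\sigma=f(1,v)1-v$, $v^{-1}=v^\sigma/q(v)$ for $v\neq 0$: (A1) $\cdot$ is $K$-bilinear; (A2) $a\cdot1=a$; (A3) $(av)v^{-1}=a$ for $v\ne0$; (B1) $h$ is $K$-bilinear; (B2) $h(a,bv)=h(b,av)+f(h(a,b),1)v$; (B3) $f(h(av,b),1)=f(h(a,b),v)$; (C) $\theta(a,v)=\frac12h(a,av)$;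 (D1) with $\pi(a):=\theta(a,1)$, $a\theta(a,v)=(a\pi(a))v$; (D2) $\pi(a)\in K1$ if and only if $a=0$; for all $a,b\in X$, $v\in L$. Put $g(a,b)=\frac12f(h(a,b),1)$. **Structurable algebras** ($\operatorname{char}K\neq2,3$). A structurable algebra over $K$ is a unital, not necessarily associative $K$-algebra with involution $\bar{\ }$ such that, with $V_{x,y}z:=\{x,y,z\}:=(x\overline y)z+(z\overline y)x-(z\overline x)y$, $[V_{x,y},V_{z,w}]=V_{\{x,y,z\},w}-V_{z,\{y,x,w\}}$ for all $x,y,z,w$. Its skew-dimension is $\dim_K\{s:\overline s=-s\}$. If it has skew-dimension one and $s_0\ne0$ is skew, its Freudenthal triple system (FTS) w.r.t. $s_0$ is given by $\langle x,y\rangle1=(x\overline y-y\overline x)s_0$ and $yzw=2\{y,s_0z,w\}-\langle z,w\rangle y-\langle z,y\rangle w-\langle y,w\rangle z$. An isometry of FTS's is a linear isomorphism preserving the triple product and the bilinear form. **Matrix algebras.** Let $J$ be a Jordan algebra over a field $\Delta$ that is either constructed from an admissible cubic form $N_J$ with base point $e_0$ ($N_J(e_0)=1$, trace form $T(x,y)=N_J(e_0;x)N_J(e_0;y)-N_J(e_0;x,y)$ nondegenerate, $x^\sharp$ defined by $T(x^\sharp,y)=N_J(x;y)$ and satisfying $(x^\sharp)^\sharp=N_J(x)x$, $x\times y=(x+y)^\sharp-x^\sharp-y^\sharp$), or from a nondegenerate quadratic form, with its nondegenerate symmetric bilinear trace form $T$, and $N_J=0$, $\times=0$. For $\eta\in\Delta^*$,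 $M(J,\eta)$ is the space of matrices $\begin{pmatrix}k_1&j_1\\ j_2&k_2\end{pmatrix}$ ($k_i\in\Delta,j_i\in J$) with involution exchanging $k_1$ and $k_2$, and product $$\begin{pmatrix}k_1&j_1\\ j_2&k_2\end{pmatrix}\begin{pmatrix}k'_1&j'_1\\ j'_2&k'_2\end{pmatrix}=\begin{pmatrix}k_1k'_1+\eta T(j_1,j'_2)&k_1j'_1+k'_2j_1+\eta(j_2\times j'_2)\\k'_1j_2+k_2j'_2+j_1\times j'_1&k_2k'_2+\eta T(j_2,j'_1)\end{pmatrix}.$$ **The algebra $X(\Omega,a,\lambda)$.** View $X$ as FTS with $xyz=\frac12(x(h(y,z)+h(z,y))+y(h(x,z)+h(z,x))+z(h(x,y)+h(y,x)))$ and $\langle x,y\rangle=g(x,y)$ (so $xxx=6x\pi(x)$). Fix $a\in X\setminus\{0\}$, let $\delta=\sqrt{-q(\pi(a))}$, which is not in $K$, $\Delta=K(\delta)$, $\iota$ the nontrivial element of $\mathrm{Gal}(\Delta/K)$, $N(d)=d\,\iota(d)$. Extend the FTS $\Delta$-linearly to $X\otimes_K\Delta$, writing $x\pi(x):=\frac16xxx$ there. Put $u_1'=\frac12(a+\frac{a\pi(a)}\delta)$, $u_2'=\frac1{2\delta}(-a+\frac{a\pi(a)}\delta)$ and $M_\epsilon=\{x\in X\otimes\Delta: u_1'u_2'x=\epsilon x\}$ for $\epsilon=\pm1$. If $g(u_1',y\pi(y))=0$ for all $y\in M_1$, put $\lambda=1$; otherwise choose $e_0\in M_1$ with $g(u_1',e_0\pi(e_0))\neq0$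 and put $\lambda=\frac12g(u_1',e_0\pi(e_0))\in\Delta^*$. Put $u_1=\lambda^{-1}u_1'$, $u_2=\lambda u_2'$. Then $X\otimes\Delta=\Delta u_1\oplus\Delta u_2\oplus M_1\oplus M_{-1}$, and there are a Jordan algebra $J$ on $M_1$ (from a nondegenerate quadratic form in the first case; from the admissible cubic form $N_J(x)=g(u_1',x\pi(x))/g(u_1',e_0\pi(e_0))$ with base point $e_0$ in the second case) and a $\Delta$-linear isomorphism $t:M_1\to M_{-1}$ such that $d_1u_1+d_2u_2+j_1+t(j_2)\mapsto\begin{pmatrix}d_1&j_1\\ j_2&d_2\end{pmatrix}$ is an isometry from $X\otimes\Delta$ to the FTS of $M(J,1)$ w.r.t. $\mathrm{diag}(1,-1)$. Let $\widetilde\eta(x\otimes d)=x\otimes\iota(d)$ (it interchanges $M_1$ and $M_{-1}$). On $\mathcal{A}'=M(J,\frac\delta{N(\lambda)})$ the map $\widetilde\pi:\begin{pmatrix}d_1&j_1\\ j_2&d_2\end{pmatrix}\mapsto\begin{pmatrix}\iota(d_2)&\widetilde\eta(t(j_2))\\t^{-1}(\widetilde\eta(j_1))&\iota(d_1)\end{pmatrix}$ is an automorphism of the algebra with involution, and its fixed point set $\mathcal{A}'^{\widetilde\pi}$ is a structurable $K$-algebra. The map $\tau:X\to\mathcal{A}'^{\widetilde\pi}$, $d_1u_1+d_2u_2+j_1+t(j_2)\mapsto\begin{pmatrix}\frac\delta{N(\lambda)}d_1&j_1\\ j_2&d_2\end{pmatrix}$ is a $K$-linear isomorphism, and $X(\Omega,a,\lambda)$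 is the $K$-space $X$ with $x\star y=\tau^{-1}(\tau(x)\tau(y))$, $\overline x=\tau^{-1}(\overline{\tau(x)})$. The operators $V_{x,y}$ in the claim are those of this algebra $(X,\star,\bar{\ })$, while $xv$ for $x\in X,v\in L$ is the action of $L$ in $\Omega$. *)

theory Defs
  imports Complex_Main "HOL-Library.Product_Plus"
begin

section \<open>Maps and forms on subspaces\<close>

definition linear_on ::
  "'a::ab_group_add set \<Rightarrow> ('k \<Rightarrow> 'a \<Rightarrow> 'a) \<Rightarrow> ('k \<Rightarrow> 'b::ab_group_add \<Rightarrow> 'b) \<Rightarrow> ('a \<Rightarrow> 'b) \<Rightarrow> bool"
  where "linear_on S s\<^sub>1 s\<^sub>2 \<phi> \<longleftrightarrow>
    (\<forall>x\<in>S. \<forall>y\<in>S. \<phi> (x + y) = \<phi> x + \<phi> y) \<and> (\<forall>c. \<forall>x\<in>S. \<phi> (s\<^sub>1 c x) = s\<^sub>2 c (\<phi> x))"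

definition bilinear_form_on ::
  "('k::field \<Rightarrow> 'a::ab_group_add \<Rightarrow> 'a) \<Rightarrow> 'a set \<Rightarrow> ('a \<Rightarrow> 'a \<Rightarrow> 'k) \<Rightarrow> bool"
  where "bilinear_form_on s S B \<longleftrightarrow>
    (\<forall>y\<in>S. linear_on S s (*) (\<lambda>x. B x y) \<and> linear_on S s (*) (B y))"

definition nondegenerate_on :: "'a::zero set \<Rightarrow> ('a \<Rightarrow> 'a \<Rightarrow> 'k::zero) \<Rightarrow> bool"
  where "nondegenerate_on S B \<longleftrightarrow> (\<forall>x\<in>S. (\<forall>y\<in>S. B x y = 0) \<longrightarrow> x = 0)"

definition polar :: "('a::plus \<Rightarrow> 'b::ab_group_add) \<Rightarrow> 'a \<Rightarrow> 'a \<Rightarrow> 'b"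
  where "polar Q x y = Q (x + y) - Q x - Q y"

definition quadratic_form_on ::
  "('k::field \<Rightarrow> 'a::ab_group_add \<Rightarrow> 'a) \<Rightarrow> 'a set \<Rightarrow> ('a \<Rightarrow> 'k) \<Rightarrow> bool"
  where "quadratic_form_on s S Q \<longleftrightarrow>
    (\<forall>c. \<forall>x\<in>S. Q (s c x) = c\<^sup>2 * Q x) \<and> bilinear_form_on s S (polar Q)"


section \<open>Quadrangular algebras\<close>

record ('k, 'l, 'x) quad_alg =
  scaleL :: "'k \<Rightarrow> 'l \<Rightarrow> 'l"
  scaleX :: "'k \<Rightarrow> 'x \<Rightarrow> 'x"
  qform :: "'l \<Rightarrow> 'k"
  unitL :: "'l"
  act :: "'x \<Rightarrow> 'l \<Rightarrow> 'x"
  hmap :: "'x \<Rightarrow> 'x \<Rightarrow> 'l"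
  thetamap :: "'x \<Rightarrow> 'l \<Rightarrow> 'l"

definition qbil :: "('k::field, 'l::ab_group_add, 'x::ab_group_add) quad_alg \<Rightarrow> 'l \<Rightarrow> 'l \<Rightarrow> 'k"
  where "qbil \<Omega> = polar (qform \<Omega>)"

definition sigma :: "('k::field, 'l::ab_group_add, 'x::ab_group_add) quad_alg \<Rightarrow> 'l \<Rightarrow> 'l"
  where "sigma \<Omega> v = scaleL \<Omega> (qbil \<Omega> (unitL \<Omega>) v) (unitL \<Omega>) - v"

definition invL :: "('k::field, 'l::ab_group_add, 'x::ab_group_add) quad_alg \<Rightarrow> 'l \<Rightarrow> 'l"
  where "invL \<Omega> v = scaleL \<Omega> (1 / qform \<Omega> v) (sigma \<Omega> v)"

definition pimap :: "('k::field, 'l::ab_group_add, 'x::ab_group_add) quad_alg \<Rightarrow> 'x \<Rightarrow> 'l"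
  where "pimap \<Omega> a = thetamap \<Omega> a (unitL \<Omega>)"

definition gform :: "('k::field, 'l::ab_group_add, 'x::ab_group_add) quad_alg \<Rightarrow> 'x \<Rightarrow> 'x \<Rightarrow> 'k"
  where "gform \<Omega> a b = 1 / 2 * qbil \<Omega> (hmap \<Omega> a b) (unitL \<Omega>)"

locale quadrangular_algebra =
  L: vector_space "scaleL \<Omega>" + X: vector_space "scaleX \<Omega>"
  for \<Omega> :: "('k::field, 'l::ab_group_add, 'x::ab_group_add) quad_alg" +
  assumes char_not_2: "CHAR('k) \<noteq> 2"
    and quadratic: "quadratic_form_on (scaleL \<Omega>) UNIV (qform \<Omega>)"
    and anisotropic: "qform \<Omega> v = 0 \<Longrightarrow> v = 0"
    and q_unit: "qform \<Omega> (unitL \<Omega>) = 1"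
    and X_nonzero: "\<exists>x::'x. x \<noteq> 0"
    and A1: "Vector_Spaces.linear (scaleX \<Omega>) (scaleX \<Omega>) (\<lambda>a. act \<Omega> a v)"
      "Vector_Spaces.linear (scaleL \<Omega>) (scaleX \<Omega>) (act \<Omega> a)"
    and A2: "act \<Omega> a (unitL \<Omega>) = a"
    and A3: "v \<noteq> 0 \<Longrightarrow> act \<Omega> (act \<Omega> a v) (invL \<Omega> v) = a"
    and B1: "Vector_Spaces.linear (scaleX \<Omega>) (scaleL \<Omega>) (\<lambda>a. hmap \<Omega> a b)"
      "Vector_Spaces.linear (scaleX \<Omega>) (scaleL \<Omega>) (hmap \<Omega> a)"
    and B2: "hmap \<Omega> a (act \<Omega> b v) =
      hmap \<Omega> b (act \<Omega> a v) + scaleL \<Omega> (qbil \<Omega> (hmap \<Omega> a b) (unitL \<Omega>)) v"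
    and B3: "qbil \<Omega> (hmap \<Omega> (act \<Omega> a v) b) (unitL \<Omega>) = qbil \<Omega> (hmap \<Omega> a b) v"
    and C: "thetamap \<Omega> a v = scaleL \<Omega> (1 / 2) (hmap \<Omega> a (act \<Omega> a v))"
    and D1: "act \<Omega> a (thetamap \<Omega> a v) = act \<Omega> (act \<Omega> a (pimap \<Omega> a)) v"
    and D2: "(\<exists>k. pimap \<Omega> a = scaleL \<Omega> k (unitL \<Omega>)) \<longleftrightarrow> a = 0"


section \<open>Algebras with involution and Freudenthal triple systems\<close>

record ('f, 'a) inv_alg =
  acarrier :: "'a set"
  ascale :: "'f \<Rightarrow> 'a \<Rightarrow> 'a"
  amult :: "'a \<Rightarrow> 'a \<Rightarrow> 'a"
  aone :: "'a"
  aconj :: "'a \<Rightarrow> 'a"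

definition V_op :: "('f, 'a::ab_group_add) inv_alg \<Rightarrow> 'a \<Rightarrow> 'a \<Rightarrow> 'a \<Rightarrow> 'a"
  where "V_op A x y z =
    amult A (amult A x (aconj A y)) z + amult A (amult A z (aconj A y)) x
      - amult A (amult A z (aconj A x)) y"

record ('f, 'w) fts =
  tcarrier :: "'w set"
  tscale :: "'f \<Rightarrow> 'w \<Rightarrow> 'w"
  tform :: "'w \<Rightarrow> 'w \<Rightarrow> 'f"
  tprod :: "'w \<Rightarrow> 'w \<Rightarrow> 'w \<Rightarrow> 'w"

definition alg_form :: "('f::field, 'a::ab_group_add) inv_alg \<Rightarrow> 'a \<Rightarrow> 'a \<Rightarrow> 'a \<Rightarrow> 'f"
  where "alg_form A s x y = (THE c. ascale A c (aone A) =
    amult A (amult A x (aconj A y) - amult A y (aconj A x)) s)"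

definition alg_triple ::
  "('f::field, 'a::ab_group_add) inv_alg \<Rightarrow> 'a \<Rightarrow> 'a \<Rightarrow> 'a \<Rightarrow> 'a \<Rightarrow> 'a"
  where "alg_triple A s y z w =
    ascale A 2 (V_op A y (amult A s z) w)
      - ascale A (alg_form A s z w) y - ascale A (alg_form A s z y) w
      - ascale A (alg_form A s y w) z"

definition alg_fts :: "('f::field, 'a::ab_group_add) inv_alg \<Rightarrow> 'a \<Rightarrow> ('f, 'a) fts"
  where "alg_fts A s =
    \<lparr>tcarrier = acarrier A, tscale = ascale A, tform = alg_form A s, tprod = alg_triple A s\<rparr>"

definition fts_isometry ::
  "('f, 'v::ab_group_add) fts \<Rightarrow> ('f, 'w::ab_group_add) fts \<Rightarrow> ('v \<Rightarrow> 'w) \<Rightarrow> bool"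
  where "fts_isometry F G \<phi> \<longleftrightarrow>
    bij_betw \<phi> (tcarrier F) (tcarrier G) \<and>
    linear_on (tcarrier F) (tscale F) (tscale G) \<phi> \<and>
    (\<forall>x\<in>tcarrier F. \<forall>y\<in>tcarrier F. tform G (\<phi> x) (\<phi> y) = tform F x y) \<and>
    (\<forall>x\<in>tcarrier F. \<forall>y\<in>tcarrier F. \<forall>z\<in>tcarrier F.
      \<phi> (tprod F x y z) = tprod G (\<phi> x) (\<phi> y) (\<phi> z))"


section \<open>Jordan data and the matrix algebras\<close>

text \<open>A Jordan algebra \<open>J\<close> enters \<open>M(J,\<eta>)\<close> only through its trace form \<open>T\<close> and the
  product \<open>\<times>\<close>, so these are what the two predicates below describe. In the quadratic case
  every nondegenerate symmetric bilinear form is the polar form of a nondegenerate quadratic form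
  (the characteristic is not 2), so no normalisation of the trace form is imposed; \<open>J = 0\<close>
  is allowed.\<close>

definition jordan_quadratic ::
  "('d::field \<Rightarrow> 'w::ab_group_add \<Rightarrow> 'w) \<Rightarrow> 'w set \<Rightarrow> ('w \<Rightarrow> 'w \<Rightarrow> 'd) \<Rightarrow> ('w \<Rightarrow> 'w \<Rightarrow> 'w) \<Rightarrow> bool"
  where "jordan_quadratic s J T X \<longleftrightarrow>
    (\<exists>Q. quadratic_form_on s J Q \<and> nondegenerate_on J (polar Q) \<and>
      (\<forall>x\<in>J. \<forall>y\<in>J. T x y = polar Q x y)) \<and>
    (\<forall>x\<in>J. \<forall>y\<in>J. X x y = 0)"

text \<open>\<open>cubic_polar N x y z\<close> is the full symmetric linearisation of a cubic form
  \<open>N\<close>, with \<open>cubic_polar N x x x = 6 * N x\<close>. The coefficient \<open>N(x;y)\<close>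
  of \<open>t\<close> in \<open>N(x + ty)\<close> is half of \<open>cubic_polar N x x y\<close>, and
  \<open>N(x;y,z)\<close> is \<open>cubic_polar N x y z\<close>.\<close>

definition cubic_polar :: "('w::ab_group_add \<Rightarrow> 'd::field) \<Rightarrow> 'w \<Rightarrow> 'w \<Rightarrow> 'w \<Rightarrow> 'd"
  where "cubic_polar N x y z =
    N (x + y + z) - N (x + y) - N (x + z) - N (y + z) + N x + N y + N z"

definition cubic_deriv :: "('w::ab_group_add \<Rightarrow> 'd::field) \<Rightarrow> 'w \<Rightarrow> 'w \<Rightarrow> 'd"
  where "cubic_deriv N x y = 1 / 2 * cubic_polar N x x y"

definition cubic_form_on ::
  "('d::field \<Rightarrow> 'w::ab_group_add \<Rightarrow> 'w) \<Rightarrow> 'w set \<Rightarrow> ('w \<Rightarrow> 'd) \<Rightarrow> bool"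
  where "cubic_form_on s J N \<longleftrightarrow>
    (\<forall>c. \<forall>x\<in>J. N (s c x) = c ^ 3 * N x) \<and>
    (\<forall>y\<in>J. \<forall>z\<in>J. linear_on J s (*) (\<lambda>x. cubic_polar N x y z))"

definition cubic_trace :: "('w::ab_group_add \<Rightarrow> 'd::field) \<Rightarrow> 'w \<Rightarrow> 'w \<Rightarrow> 'w \<Rightarrow> 'd"
  where "cubic_trace N e x y = cubic_deriv N e x * cubic_deriv N e y - cubic_polar N e x y"

definition admissible_cubic ::
  "('d::field \<Rightarrow> 'w::ab_group_add \<Rightarrow> 'w) \<Rightarrow> 'w set \<Rightarrow> ('w \<Rightarrow> 'd) \<Rightarrow> 'w \<Rightarrow> ('w \<Rightarrow> 'w) \<Rightarrow> bool"
  where "admissible_cubic s J N e sh \<longleftrightarrow>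
    cubic_form_on s J N \<and> e \<in> J \<and> N e = 1 \<and> nondegenerate_on J (cubic_trace N e) \<and>
    (\<forall>x\<in>J. sh x \<in> J \<and> (\<forall>y\<in>J. cubic_trace N e (sh x) y = cubic_deriv N x y)) \<and>
    (\<forall>x\<in>J. sh (sh x) = s (N x) x)"

definition jordan_cubic ::
  "('d::field \<Rightarrow> 'w::ab_group_add \<Rightarrow> 'w) \<Rightarrow> 'w set \<Rightarrow> ('w \<Rightarrow> 'd) \<Rightarrow> 'w \<Rightarrow>
    ('w \<Rightarrow> 'w \<Rightarrow> 'd) \<Rightarrow> ('w \<Rightarrow> 'w \<Rightarrow> 'w) \<Rightarrow> bool"
  where "jordan_cubic s J N e T X \<longleftrightarrow>
    (\<exists>sh. admissible_cubic s J N e sh \<and>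
      (\<forall>x\<in>J. \<forall>y\<in>J. T x y = cubic_trace N e x y \<and> X x y = sh (x + y) - sh x - sh y))"

text \<open>The tuple \<open>(k\<^sub>1, j\<^sub>1, j\<^sub>2, k\<^sub>2)\<close> is the matrix with first row
  \<open>k\<^sub>1, j\<^sub>1\<close> and second row \<open>j\<^sub>2, k\<^sub>2\<close>.\<close>

type_synonym ('d, 'w) jmat = "'d \<times> 'w \<times> 'w \<times> 'd"

definition matrix_alg ::
  "('d::field \<Rightarrow> 'w::ab_group_add \<Rightarrow> 'w) \<Rightarrow> 'w set \<Rightarrow> ('w \<Rightarrow> 'w \<Rightarrow> 'd) \<Rightarrow> ('w \<Rightarrow> 'w \<Rightarrow> 'w) \<Rightarrow>
    'd \<Rightarrow> ('d, ('d, 'w) jmat) inv_alg"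
  where "matrix_alg s J T X \<eta> =
    \<lparr>acarrier = UNIV \<times> J \<times> J \<times> UNIV,
     ascale = (\<lambda>c (k\<^sub>1, j\<^sub>1, j\<^sub>2, k\<^sub>2). (c * k\<^sub>1, s c j\<^sub>1, s c j\<^sub>2, c * k\<^sub>2)),
     amult = (\<lambda>(k\<^sub>1, j\<^sub>1, j\<^sub>2, k\<^sub>2) (l\<^sub>1, i\<^sub>1, i\<^sub>2, l\<^sub>2).
       (k\<^sub>1 * l\<^sub>1 + \<eta> * T j\<^sub>1 i\<^sub>2,
        s k\<^sub>1 i\<^sub>1 + s l\<^sub>2 j\<^sub>1 + s \<eta> (X j\<^sub>2 i\<^sub>2),
        s l\<^sub>1 j\<^sub>2 + s k\<^sub>2 i\<^sub>2 + X j\<^sub>1 i\<^sub>1,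
        k\<^sub>2 * l\<^sub>2 + \<eta> * T j\<^sub>2 i\<^sub>1)),
     aone = (1, 0, 0, 1),
     aconj = (\<lambda>(k\<^sub>1, j\<^sub>1, j\<^sub>2, k\<^sub>2). (k\<^sub>2, j\<^sub>1, j\<^sub>2, k\<^sub>1))\<rparr>"


section \<open>The algebra \<open>X(\<Omega>, a, \<lambda>)\<close>\<close>

text \<open>The choices made in the construction: the point \<open>a\<close>, the field \<open>\<Delta>\<close> (the
  type \<open>'d\<close>, with \<open>emb\<close> the inclusion of \<open>K\<close>), \<open>\<delta>\<close>,
  \<open>\<iota>\<close>, \<open>e\<^sub>0\<close> (ignored when \<open>\<lambda> = 1\<close> is forced), the trace
  form and the product \<open>\<times>\<close> of \<open>J\<close>, and the isomorphism \<open>t\<close>.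
  As \<open>1, \<delta>\<close> is a \<open>K\<close>-basis of \<open>\<Delta>\<close>, the space
  \<open>X \<otimes> \<Delta>\<close> is \<open>X \<times> X\<close>, where \<open>(x, y)\<close> stands for
  \<open>x \<otimes> 1 + y \<otimes> \<delta>\<close>.\<close>

record ('k, 'x, 'd) X_data =
  pt :: "'x"
  emb :: "'k \<Rightarrow> 'd"
  delta :: "'d"
  iota :: "'d \<Rightarrow> 'd"
  e0 :: "'x \<times> 'x"
  traceJ :: "'x \<times> 'x \<Rightarrow> 'x \<times> 'x \<Rightarrow> 'd"
  crossJ :: "'x \<times> 'x \<Rightarrow> 'x \<times> 'x \<Rightarrow> 'x \<times> 'x"
  tmap :: "'x \<times> 'x \<Rightarrow> 'x \<times> 'x"

definition coords :: "('k::field, 'x::ab_group_add, 'd::field) X_data \<Rightarrow> 'd \<Rightarrow> 'k \<times> 'k"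
  where "coords C = the_inv (\<lambda>(r, s). emb C r + emb C s * delta C)"

definition inc :: "'x::ab_group_add \<Rightarrow> 'x \<times> 'x"
  where "inc x = (x, 0)"

text \<open>Note \<open>\<delta>\<^sup>2 = - q(\<pi>(a))\<close> lies in \<open>K\<close>.\<close>

definition scaleW ::
  "('k::field, 'l::ab_group_add, 'x::ab_group_add) quad_alg \<Rightarrow> ('k, 'x, 'd::field) X_data \<Rightarrow>
    'd \<Rightarrow> 'x \<times> 'x \<Rightarrow> 'x \<times> 'x"
  where "scaleW \<Omega> C d = (\<lambda>(x, y). case coords C d of (r, s) \<Rightarrow>
    (scaleX \<Omega> r x + scaleX \<Omega> (s * - qform \<Omega> (pimap \<Omega> (pt C))) y,
     scaleX \<Omega> r y + scaleX \<Omega> s x))"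

definition X_triple ::
  "('k::field, 'l::ab_group_add, 'x::ab_group_add) quad_alg \<Rightarrow> 'x \<Rightarrow> 'x \<Rightarrow> 'x \<Rightarrow> 'x"
  where "X_triple \<Omega> x y z = scaleX \<Omega> (1 / 2)
    (act \<Omega> x (hmap \<Omega> y z + hmap \<Omega> z y) + act \<Omega> y (hmap \<Omega> x z + hmap \<Omega> z x)
      + act \<Omega> z (hmap \<Omega> x y + hmap \<Omega> y x))"

definition W_triple ::
  "('k::field, 'l::ab_group_add, 'x::ab_group_add) quad_alg \<Rightarrow> ('k, 'x, 'd::field) X_data \<Rightarrow>
    'x \<times> 'x \<Rightarrow> 'x \<times> 'x \<Rightarrow> 'x \<times> 'x \<Rightarrow> 'x \<times> 'x"
  where "W_triple \<Omega> C = (\<lambda>(x\<^sub>0, x\<^sub>1) (y\<^sub>0, y\<^sub>1) (z\<^sub>0, z\<^sub>1).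
    let p = X_triple \<Omega>; D = delta C in
      inc (p x\<^sub>0 y\<^sub>0 z\<^sub>0)
      + scaleW \<Omega> C D (inc (p x\<^sub>1 y\<^sub>0 z\<^sub>0 + p x\<^sub>0 y\<^sub>1 z\<^sub>0 + p x\<^sub>0 y\<^sub>0 z\<^sub>1))
      + scaleW \<Omega> C (D ^ 2) (inc (p x\<^sub>1 y\<^sub>1 z\<^sub>0 + p x\<^sub>1 y\<^sub>0 z\<^sub>1 + p x\<^sub>0 y\<^sub>1 z\<^sub>1))
      + scaleW \<Omega> C (D ^ 3) (inc (p x\<^sub>1 y\<^sub>1 z\<^sub>1)))"

definition W_form ::
  "('k::field, 'l::ab_group_add, 'x::ab_group_add) quad_alg \<Rightarrow> ('k, 'x, 'd::field) X_data \<Rightarrow>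
    'x \<times> 'x \<Rightarrow> 'x \<times> 'x \<Rightarrow> 'd"
  where "W_form \<Omega> C = (\<lambda>(x\<^sub>0, x\<^sub>1) (y\<^sub>0, y\<^sub>1).
    let g = gform \<Omega>; D = delta C in
      emb C (g x\<^sub>0 y\<^sub>0) + D * emb C (g x\<^sub>1 y\<^sub>0 + g x\<^sub>0 y\<^sub>1) + D ^ 2 * emb C (g x\<^sub>1 y\<^sub>1))"

definition W_fts ::
  "('k::field, 'l::ab_group_add, 'x::ab_group_add) quad_alg \<Rightarrow> ('k, 'x, 'd::field) X_data \<Rightarrow>
    ('d, 'x \<times> 'x) fts"
  where "W_fts \<Omega> C =
    \<lparr>tcarrier = UNIV, tscale = scaleW \<Omega> C, tform = W_form \<Omega> C, tprod = W_triple \<Omega> C\<rparr>"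

text \<open>\<open>W_cube \<Omega> C x\<close> is what the theory writes as \<open>x\<pi>(x)\<close> on
  \<open>X \<otimes> \<Delta>\<close>.\<close>

definition W_cube ::
  "('k::field, 'l::ab_group_add, 'x::ab_group_add) quad_alg \<Rightarrow> ('k, 'x, 'd::field) X_data \<Rightarrow>
    'x \<times> 'x \<Rightarrow> 'x \<times> 'x"
  where "W_cube \<Omega> C x = scaleW \<Omega> C (1 / 6) (W_triple \<Omega> C x x x)"

definition a_pi_a ::
  "('k::field, 'l::ab_group_add, 'x::ab_group_add) quad_alg \<Rightarrow> ('k, 'x, 'd::field) X_data \<Rightarrow> 'x"
  where "a_pi_a \<Omega> C = act \<Omega> (pt C) (pimap \<Omega> (pt C))"

definition u1' ::
  "('k::field, 'l::ab_group_add, 'x::ab_group_add) quad_alg \<Rightarrow> ('k, 'x, 'd::field) X_data \<Rightarrow> 'x \<times> 'x"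
  where "u1' \<Omega> C = scaleW \<Omega> C (1 / 2)
    (inc (pt C) + scaleW \<Omega> C (1 / delta C) (inc (a_pi_a \<Omega> C)))"

definition u2' ::
  "('k::field, 'l::ab_group_add, 'x::ab_group_add) quad_alg \<Rightarrow> ('k, 'x, 'd::field) X_data \<Rightarrow> 'x \<times> 'x"
  where "u2' \<Omega> C = scaleW \<Omega> C (1 / (2 * delta C))
    (- inc (pt C) + scaleW \<Omega> C (1 / delta C) (inc (a_pi_a \<Omega> C)))"

definition M_eps ::
  "('k::field, 'l::ab_group_add, 'x::ab_group_add) quad_alg \<Rightarrow> ('k, 'x, 'd::field) X_data \<Rightarrow>
    'd \<Rightarrow> ('x \<times> 'x) set"
  where "M_eps \<Omega> C \<epsilon> = {x. W_triple \<Omega> C (u1' \<Omega> C) (u2' \<Omega> C) x = scaleW \<Omega> C \<epsilon> x}"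

definition cubic_val ::
  "('k::field, 'l::ab_group_add, 'x::ab_group_add) quad_alg \<Rightarrow> ('k, 'x, 'd::field) X_data \<Rightarrow>
    'x \<times> 'x \<Rightarrow> 'd"
  where "cubic_val \<Omega> C y = W_form \<Omega> C (u1' \<Omega> C) (W_cube \<Omega> C y)"

definition first_case ::
  "('k::field, 'l::ab_group_add, 'x::ab_group_add) quad_alg \<Rightarrow> ('k, 'x, 'd::field) X_data \<Rightarrow> bool"
  where "first_case \<Omega> C \<longleftrightarrow> (\<forall>y \<in> M_eps \<Omega> C 1. cubic_val \<Omega> C y = 0)"

definition lam ::
  "('k::field, 'l::ab_group_add, 'x::ab_group_add) quad_alg \<Rightarrow> ('k, 'x, 'd::field) X_data \<Rightarrow> 'd"
  where "lam \<Omega> C = (if first_case \<Omega> C then 1 else 1 / 2 * cubic_val \<Omega> C (e0 C))"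

definition N_lam ::
  "('k::field, 'l::ab_group_add, 'x::ab_group_add) quad_alg \<Rightarrow> ('k, 'x, 'd::field) X_data \<Rightarrow> 'd"
  where "N_lam \<Omega> C = lam \<Omega> C * iota C (lam \<Omega> C)"

definition u1 ::
  "('k::field, 'l::ab_group_add, 'x::ab_group_add) quad_alg \<Rightarrow> ('k, 'x, 'd::field) X_data \<Rightarrow> 'x \<times> 'x"
  where "u1 \<Omega> C = scaleW \<Omega> C (1 / lam \<Omega> C) (u1' \<Omega> C)"

definition u2 ::
  "('k::field, 'l::ab_group_add, 'x::ab_group_add) quad_alg \<Rightarrow> ('k, 'x, 'd::field) X_data \<Rightarrow> 'x \<times> 'x"
  where "u2 \<Omega> C = scaleW \<Omega> C (lam \<Omega> C) (u2' \<Omega> C)"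

definition MJ ::
  "('k::field, 'l::ab_group_add, 'x::ab_group_add) quad_alg \<Rightarrow> ('k, 'x, 'd::field) X_data \<Rightarrow>
    'd \<Rightarrow> ('d, ('d, 'x \<times> 'x) jmat) inv_alg"
  where "MJ \<Omega> C \<eta> = matrix_alg (scaleW \<Omega> C) (M_eps \<Omega> C 1) (traceJ C) (crossJ C) \<eta>"

definition assemble ::
  "('k::field, 'l::ab_group_add, 'x::ab_group_add) quad_alg \<Rightarrow> ('k, 'x, 'd::field) X_data \<Rightarrow>
    ('d, 'x \<times> 'x) jmat \<Rightarrow> 'x \<times> 'x"
  where "assemble \<Omega> C = (\<lambda>(d\<^sub>1, j\<^sub>1, j\<^sub>2, d\<^sub>2).
    scaleW \<Omega> C d\<^sub>1 (u1 \<Omega> C) + scaleW \<Omega> C d\<^sub>2 (u2 \<Omega> C) + j\<^sub>1 + tmap C j\<^sub>2)"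

text \<open>\<open>to_matrix\<close> is the map
  \<open>d\<^sub>1u\<^sub>1 + d\<^sub>2u\<^sub>2 + j\<^sub>1 + t(j\<^sub>2) \<mapsto> (d\<^sub>1, j\<^sub>1, j\<^sub>2, d\<^sub>2)\<close>.\<close>

definition to_matrix ::
  "('k::field, 'l::ab_group_add, 'x::ab_group_add) quad_alg \<Rightarrow> ('k, 'x, 'd::field) X_data \<Rightarrow>
    'x \<times> 'x \<Rightarrow> ('d, 'x \<times> 'x) jmat"
  where "to_matrix \<Omega> C = the_inv_into (acarrier (MJ \<Omega> C 1)) (assemble \<Omega> C)"

locale X_construction = quadrangular_algebra \<Omega>
  for \<Omega> :: "('k::field, 'l::ab_group_add, 'x::ab_group_add) quad_alg" +
  fixes C :: "('k, 'x, 'd::field) X_data"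
  assumes char_not_3: "CHAR('k) \<noteq> 3"
    and pt_nonzero: "pt C \<noteq> 0"
    and emb_add: "emb C (r + s) = emb C r + emb C s"
    and emb_mult: "emb C (r * s) = emb C r * emb C s"
    and emb_one: "emb C 1 = 1"
    and delta_sq: "delta C ^ 2 = - emb C (qform \<Omega> (pimap \<Omega> (pt C)))"
    and delta_not_in_K: "delta C \<notin> range (emb C)"
    and Delta_generated: "\<exists>r s. d = emb C r + emb C s * delta C"
    and iota_add: "iota C (d + d') = iota C d + iota C d'"
    and iota_mult: "iota C (d * d') = iota C d * iota C d'"
    and iota_emb: "iota C (emb C r) = emb C r"
    and iota_bij: "bij (iota C)"
    and iota_nontrivial: "iota C \<noteq> id"
    and e0_choice: "\<not> first_case \<Omega> C \<Longrightarrow> e0 C \<in> M_eps \<Omega> C 1 \<and> cubic_val \<Omega> C (e0 C) \<noteq> 0"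
    and J_first: "first_case \<Omega> C \<Longrightarrow>
      jordan_quadratic (scaleW \<Omega> C) (M_eps \<Omega> C 1) (traceJ C) (crossJ C)"
    and J_second: "\<not> first_case \<Omega> C \<Longrightarrow>
      jordan_cubic (scaleW \<Omega> C) (M_eps \<Omega> C 1)
        (\<lambda>x. cubic_val \<Omega> C x / cubic_val \<Omega> C (e0 C)) (e0 C) (traceJ C) (crossJ C)"
    and t_linear: "linear_on (M_eps \<Omega> C 1) (scaleW \<Omega> C) (scaleW \<Omega> C) (tmap C)"
    and t_bij: "bij_betw (tmap C) (M_eps \<Omega> C 1) (M_eps \<Omega> C (- 1))"
    and decomposition: "bij_betw (assemble \<Omega> C) (acarrier (MJ \<Omega> C 1)) UNIV"
    and isometry: "fts_isometry (W_fts \<Omega> C) (alg_fts (MJ \<Omega> C 1) (1, 0, 0, - 1)) (to_matrix \<Omega> C)"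

text \<open>\<open>\<eta>~(x \<otimes> d) = x \<otimes> \<iota>(d)\<close>.\<close>

definition eta_tilde ::
  "('k::field, 'l::ab_group_add, 'x::ab_group_add) quad_alg \<Rightarrow> ('k, 'x, 'd::field) X_data \<Rightarrow>
    'x \<times> 'x \<Rightarrow> 'x \<times> 'x"
  where "eta_tilde \<Omega> C = (\<lambda>(x, y). inc x + scaleW \<Omega> C (iota C (delta C)) (inc y))"

definition pi_tilde ::
  "('k::field, 'l::ab_group_add, 'x::ab_group_add) quad_alg \<Rightarrow> ('k, 'x, 'd::field) X_data \<Rightarrow>
    ('d, 'x \<times> 'x) jmat \<Rightarrow> ('d, 'x \<times> 'x) jmat"
  where "pi_tilde \<Omega> C = (\<lambda>(d\<^sub>1, j\<^sub>1, j\<^sub>2, d\<^sub>2).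
    (iota C d\<^sub>2, eta_tilde \<Omega> C (tmap C j\<^sub>2),
     the_inv_into (M_eps \<Omega> C 1) (tmap C) (eta_tilde \<Omega> C j\<^sub>1), iota C d\<^sub>1))"

definition fixed_alg ::
  "('k::field, 'l::ab_group_add, 'x::ab_group_add) quad_alg \<Rightarrow> ('k, 'x, 'd::field) X_data \<Rightarrow>
    ('k, ('d, 'x \<times> 'x) jmat) inv_alg"
  where "fixed_alg \<Omega> C = (let A = MJ \<Omega> C (delta C / N_lam \<Omega> C) in
    \<lparr>acarrier = {m \<in> acarrier A. pi_tilde \<Omega> C m = m},
     ascale = (\<lambda>k. ascale A (emb C k)), amult = amult A, aone = aone A, aconj = aconj A\<rparr>)"

definition tau ::
  "('k::field, 'l::ab_group_add, 'x::ab_group_add) quad_alg \<Rightarrow> ('k, 'x, 'd::field) X_data \<Rightarrow>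
    'x \<Rightarrow> ('d, 'x \<times> 'x) jmat"
  where "tau \<Omega> C x = (case to_matrix \<Omega> C (inc x) of (d\<^sub>1, j\<^sub>1, j\<^sub>2, d\<^sub>2) \<Rightarrow>
    (delta C / N_lam \<Omega> C * d\<^sub>1, j\<^sub>1, j\<^sub>2, d\<^sub>2))"

text \<open>\<open>tau\<close> is a bijection from \<open>X\<close> onto the carrier of \<open>fixed_alg\<close>, so
  \<open>the_inv\<close> inverts it there.\<close>

definition X_alg ::
  "('k::field, 'l::ab_group_add, 'x::ab_group_add) quad_alg \<Rightarrow> ('k, 'x, 'd::field) X_data \<Rightarrow>
    ('k, 'x) inv_alg"
  where "X_alg \<Omega> C = (let A = fixed_alg \<Omega> C; \<tau> = tau \<Omega> C in
    \<lparr>acarrier = UNIV, ascale = scaleX \<Omega>,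
     amult = (\<lambda>x y. the_inv \<tau> (amult A (\<tau> x) (\<tau> y))),
     aone = the_inv \<tau> (aone A),
     aconj = (\<lambda>x. the_inv \<tau> (aconj A (\<tau> x)))\<rparr>)"

text \<open>The defining expression is an element of \<open>X \<otimes> \<Delta>\<close> that lies in
  \<open>X \<otimes> 1\<close>; \<open>the_inv inc\<close> returns it to \<open>X\<close>.\<close>

definition s0 ::
  "('k::field, 'l::ab_group_add, 'x::ab_group_add) quad_alg \<Rightarrow> ('k, 'x, 'd::field) X_data \<Rightarrow> 'x"
  where "s0 \<Omega> C = (let s = scaleW \<Omega> C; a = inc (pt C);
      b = s (1 / delta C) (inc (a_pi_a \<Omega> C)); l = lam \<Omega> C in
    the_inv inc (s (N_lam \<Omega> C / (2 * delta C ^ 2)) (s (iota C l) (a + b) - s l (- a + b))))"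

end

theory Submission
  imports Defs "HOL-Computational_Algebra.Primes"
begin

text \<open>
  The right action of \<open>v\<close> is a similarity of the Freudenthal triple system \<open>X\<close> with multiplier
  \<open>q(v)\<close>: both \<open>g(xv,yv) = q(v)g(x,y)\<close> and \<open>(xv)(yv)(zv) = q(v)((xyz)v)\<close> hold. On the other
  hand, the operators \<open>V\<close> of \<open>X(\<Omega>,a,\<lambda>)\<close> are determined by the triple system:
  \<open>2V(x, s\<^sub>0 \<star> y)z = xyz + \<langle>y,z\<rangle>x + \<langle>y,x\<rangle>z + \<langle>x,z\<rangle>y\<close> (lemma \<open>V_eq\<close>). Every term on the right is
  multiplied by \<open>q(v)\<close> and by the action of \<open>v\<close> when \<open>x\<close>, \<open>y\<close>, \<open>z\<close> are replaced by
  \<open>xv\<close>, \<open>yv\<close>, \<open>zv\<close>, and the claim follows.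

  The similarity of the triple product (\<open>X_triple_act\<close>) is the linearisation of
  \<open>(xv)\<pi>(xv) = q(v)(x\<pi>(x))v\<close> (\<open>cube_act\<close>), which is possible as 6 is invertible. That identity
  comes from axiom (D1) at the point \<open>xv\<close> and the Clifford relations for the action.

  For the formula for \<open>V\<close> put \<open>\<eta> = \<delta>/N(\<lambda>)\<close>. The map \<open>\<tau>\<close> is the isometry from \<open>X \<otimes> \<Delta>\<close> to
  \<open>M(J,1)\<close>, restricted to \<open>X\<close> and followed by multiplication of the upper left entry by \<open>\<eta>\<close>.
  This multiplication carries the operators \<open>V\<close> of \<open>M(J,1)\<close> to those of \<open>M(J,\<eta>)\<close>
  (\<open>V_rescale\<close>), and \<open>\<tau>(s\<^sub>0) = \<eta>\<^sup>-\<^sup>1 diag(1,-1)\<close> (\<open>tau_s0\<close>). In \<open>M(J,1)\<close> the formula is the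
  definition of the triple product with respect to \<open>diag(1,-1)\<close>.

  This argument needs \<open>\<tau>\<close> to be multiplicative, that is, the range of \<open>\<tau>\<close> to be closed under
  products. The map \<open>x \<otimes> d \<mapsto> x \<otimes> \<iota>(d)\<close> is a semilinear automorphism of the triple system
  \<open>X \<otimes> \<Delta>\<close>. As the trace form and the cross product of \<open>J\<close> can be read off from the form
  and the triple product of \<open>M(J,1)\<close>, this makes \<open>\<pi>~\<close> multiplicative on \<open>M(J,\<eta>)\<close>
  (\<open>pit_mult\<close>), and the range of \<open>\<tau>\<close> is its fixed point set (\<open>pit_tau\<close>, \<open>fixed_tau\<close>).
\<close>

section \<open>Similarities of the triple system of a quadrangular algebra\<close>

lemma of_nat_prime_nonzero:
  assumes "CHAR('k::field) \<noteq> p" "prime p" shows "of_nat p \<noteq> (0::'k)"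
proof
  assume "of_nat p = (0::'k)"
  then have "CHAR('k) dvd p" by (simp only: of_nat_eq_0_iff_char_dvd)
  moreover have "CHAR('k) \<noteq> 1" by (simp add: CHAR_not_1')
  ultimately show False using assms prime_nat_iff by blast
qed

lemma polar_comm: "polar Q (x::'a::ab_group_add) y = polar Q y x"
  by (simp add: polar_def add.commute)

context quadrangular_algebra
begin

abbreviation "q \<equiv> qform \<Omega>"
abbreviation "f \<equiv> qbil \<Omega>"
abbreviation "e \<equiv> unitL \<Omega>"
abbreviation "ac \<equiv> act \<Omega>"
abbreviation "h \<equiv> hmap \<Omega>"
abbreviation "sL \<equiv> scaleL \<Omega>"
abbreviation "sX \<equiv> scaleX \<Omega>"
abbreviation "g \<equiv> gform \<Omega>"

lemma two_nonzero: "(2::'k) \<noteq> 0"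
  using of_nat_prime_nonzero[of 2] char_not_2 by simp

lemma act_add_left: "ac (a + b) v = ac a v + ac b v"
  and act_scale_left: "ac (sX r a) v = sX r (ac a v)"
  and act_add_right: "ac a (v + w) = ac a v + ac a w"
  and act_scale_right: "ac a (sL r v) = sX r (ac a v)"
  and hmap_add_left: "h (a + b) c = h a c + h b c"
  and hmap_scale_left: "h (sX r a) c = sL r (h a c)"
  and hmap_add_right: "h a (b + c) = h a b + h a c"
  and hmap_scale_right: "h a (sX r c) = sL r (h a c)"
  using A1 B1 by (auto simp: Vector_Spaces.linear_iff)

lemmas bilin = act_add_left act_scale_left act_add_right act_scale_right
  hmap_add_left hmap_scale_left hmap_add_right hmap_scale_right

lemma q_scale: "q (sL c v) = c\<^sup>2 * q v"
  using quadratic by (simp add: quadratic_form_on_def)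

lemma f_comm: "f v w = f w v"
  by (simp add: qbil_def polar_comm)

lemma f_add_left: "f (v + w) u = f v u + f w u"
  and f_scale_left: "f (sL c v) u = c * f v u"
  using quadratic by (auto simp: quadratic_form_on_def bilinear_form_on_def linear_on_def qbil_def)

lemma f_add_right: "f u (v + w) = f u v + f u w"
  and f_scale_right: "f u (sL c v) = c * f u v"
  using f_add_left f_scale_left f_comm by metis+

lemma f_minus_left: "f (- v) u = - f v u"
  using f_scale_left[of "- 1" v u] by (simp add: L.scale_minus_left)

lemma f_minus_right: "f u (- v) = - f u v"
  using f_minus_left f_comm by metis

lemma f_diff_left: "f (v - w) u = f v u - f w u"
  and f_diff_right: "f u (v - w) = f u v - f u w"
  using f_add_left[of v "- w" u] f_add_right[of u v "- w"]
  by (simp_all add: f_minus_left f_minus_right)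

lemmas f_bilin = f_add_left f_scale_left f_add_right f_scale_right f_diff_left f_diff_right
  f_minus_left f_minus_right

lemma f_self: "f v v = 2 * q v"
proof -
  have "q (v + v) = q (sL 2 v)"
    using L.scale_left_distrib[of 1 1 v] by simp
  then show ?thesis
    by (simp add: qbil_def polar_def q_scale power2_eq_square)
qed

lemma act_zero_left: "ac 0 v = 0"
  using act_scale_left[of 0 0 v] by simp

lemma act_zero_right: "ac a 0 = 0"
  using act_scale_right[of a 0 0] by simp

lemma act_minus_left: "ac (- a) v = - ac a v"
  using act_scale_left[of "- 1" a v] by (simp add: X.scale_minus_left)

lemma act_minus_right: "ac a (- v) = - ac a v"
  using act_scale_right[of a "- 1" v] by (simp add: L.scale_minus_left)

lemma act_diff_right: "ac a (v - w) = ac a v - ac a w"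
  using act_add_right[of a v "- w"] by (simp add: act_minus_right)

lemma act_diff_left: "ac (a - b) v = ac a v - ac b v"
  using act_add_left[of a "- b" v] by (simp add: act_minus_left)

lemma q_zero: "q 0 = 0"
  using q_scale[of 0 0] by simp

lemma act_sigma: "ac (ac a v) (sigma \<Omega> v) = sX (q v) a"
proof (cases "v = 0")
  case False
  then have "q v \<noteq> 0" using anisotropic by blast
  moreover have "a = sX (1 / q v) (ac (ac a v) (sigma \<Omega> v))"
    using A3[OF False, of a] by (simp add: invL_def act_scale_right)
  then have "sX (q v) a = sX (q v) (sX (1 / q v) (ac (ac a v) (sigma \<Omega> v)))" by simp
  ultimately show ?thesis by simp
qed (simp add: act_zero_left act_zero_right q_zero sigma_def f_comm)

lemma sigma_add: "sigma \<Omega> (u + v) = sigma \<Omega> u + sigma \<Omega> v"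
  by (simp add: sigma_def f_bilin L.scale_left_distrib)

text \<open>Linearising \<open>(av)v\<^sup>\<sigma> = q(v)a\<close>: \<open>X\<close> is a module over the Clifford algebra of
  \<open>q\<close> with base point \<open>1\<close>.\<close>

lemma act_sigma_polar:
  "ac (ac a u) (sigma \<Omega> v) + ac (ac a v) (sigma \<Omega> u) = sX (f u v) a"
proof -
  have "q (u + v) = q u + q v + f u v"
    by (simp add: qbil_def polar_def)
  then show ?thesis
    using act_sigma[of a "u + v"]
    by (simp add: act_sigma sigma_add bilin X.scale_left_distrib algebra_simps)
qed

text \<open>The case \<open>v = 1\<close> of (B2); as \<open>v\<^sup>\<sigma> = f(1,v)1 - v\<close>, it says that
  \<open>h(b,a) = -h(a,b)\<^sup>\<sigma>\<close>.\<close>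

lemma hmap_swap: "h b a = h a b - sL (f (h a b) e) e"
  using B2[of a b e] by (simp add: A2 algebra_simps)

lemma f_unit: "f e e = 2"
  by (simp add: f_self q_unit)

lemma sigma_sigma: "sigma \<Omega> (sigma \<Omega> v) = v"
  by (simp add: sigma_def f_bilin f_unit L.scale_left_distrib[symmetric] algebra_simps)

lemma gform_skew: "g b a = - g a b"
  using two_nonzero by (simp add: gform_def hmap_swap[of b a] f_bilin f_unit field_simps)

lemma gform_act: "g (ac a v) (ac b v) = q v * g a b"
proof -
  have 1: "2 * g (ac a v) (ac b v) = f (h a (ac b v)) v" for a b
    using B3[of a v "ac b v"] two_nonzero by (simp add: gform_def)
  have "f (h a (ac b v)) v = f (h b (ac a v)) v + 4 * g a b * q v"
    using two_nonzero by (simp add: B2[of a b v] f_bilin f_self gform_def)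
  then have "2 * g (ac a v) (ac b v) = - (2 * g (ac a v) (ac b v)) + 4 * g a b * q v"
    using 1[of a b] 1[of b a] gform_skew[of "ac a v" "ac b v"] by simp
  then have "4 * g (ac a v) (ac b v) = 4 * (q v * g a b)" by (simp add: algebra_simps)
  moreover have "(4::'k) = 2 * 2" by simp
  ultimately show ?thesis using two_nonzero by (metis mult_cancel_left mult_eq_0_iff)
qed

lemma f_hmap_self: "f (h x x) e = 0"
proof -
  have "2 * g x x = 0" using gform_skew[of x x] by (simp add: eq_neg_iff_add_eq_0)
  then show ?thesis using two_nonzero by (simp add: gform_def)
qed

lemma act_sigma_eq: "ac b (sigma \<Omega> v) = sX (f e v) b - ac b v"
  by (simp add: sigma_def act_diff_right act_scale_right A2)

lemma double_f_theta_unit: "2 * f (thetamap \<Omega> x v) e = - f (h x x) v"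
proof -
  have "2 * f (thetamap \<Omega> x v) e = f (h x (ac x v)) e"
    using two_nonzero by (simp add: C f_bilin)
  also have "\<dots> = - f (h (ac x v) x) e"
    using hmap_swap[of x "ac x v"] by (simp add: f_bilin f_unit)
  also have "\<dots> = - f (h x x) v" by (simp add: B3)
  finally show ?thesis .
qed

text \<open>By (B3), this is \<open>g(xv,xv) = 0\<close>.\<close>

lemma f_theta_self: "f (thetamap \<Omega> x v) v = 0"
proof -
  have "f (h x (ac x v)) v = f (h (ac x v) (ac x v)) e" by (simp add: B3)
  also have "\<dots> = 0" by (rule f_hmap_self)
  finally show ?thesis by (simp add: C f_bilin)
qed

lemma pimap_eq: "pimap \<Omega> x = sL (1/2) (h x x)"
  by (simp add: pimap_def C A2)

lemma f_theta_unit: "f (thetamap \<Omega> x v) e = - f (pimap \<Omega> x) v"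
  using double_f_theta_unit[of x v] two_nonzero by (simp add: pimap_eq f_bilin field_simps)

text \<open>This is the linearised Clifford relation for the pair \<open>v\<close>, \<open>\<theta>(x,v)\<^sup>\<sigma>\<close>, in which (D1)
  evaluates \<open>x\<theta>(x,v)\<close>.\<close>

lemma act_act_theta:
  "ac (ac x v) (thetamap \<Omega> x v) = sX (q v) (ac x (pimap \<Omega> x)) - sX (f (pimap \<Omega> x) v) (ac x v)"
proof -
  let ?t = "thetamap \<Omega> x v" and ?p = "f (pimap \<Omega> x) v"
  have s: "sigma \<Omega> ?t = - sL ?p e - ?t"
    using f_theta_unit[of x v] by (simp add: sigma_def f_comm[of e])
  have xs: "ac x (sigma \<Omega> ?t) = - sX ?p x - ac (ac x (pimap \<Omega> x)) v"
    by (simp add: s act_diff_right act_minus_right act_scale_right A2 D1)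
  have "f (sigma \<Omega> ?t) v = - ?p * f e v"
    by (simp add: s f_bilin f_theta_self)
  then have "ac (ac x (sigma \<Omega> ?t)) (sigma \<Omega> v) + ac (ac x v) ?t = sX (- ?p * f e v) x"
    using act_sigma_polar[of x "sigma \<Omega> ?t" v] by (simp add: sigma_sigma)
  then have "- sX ?p (ac x (sigma \<Omega> v)) - sX (q v) (ac x (pimap \<Omega> x)) + ac (ac x v) ?t
      = sX (- ?p * f e v) x"
    by (simp add: xs act_diff_left act_minus_left act_scale_left act_sigma)
  then show ?thesis
    by (simp add: act_sigma_eq X.scale_right_diff_distrib algebra_simps X.scale_minus_left)
qed

lemma act_sigma_act: "ac (ac b (sigma \<Omega> v)) v = sX (q v) b"
proof -
  have "q (sigma \<Omega> v) = q v"
  proof -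
    have "2 * q (sigma \<Omega> v) = 2 * q v"
      unfolding f_self[symmetric]
      by (simp add: sigma_def f_bilin f_unit f_comm[of v e])
    then show ?thesis using two_nonzero by simp
  qed
  then show ?thesis using act_sigma[of b "sigma \<Omega> v"] by (simp add: sigma_sigma)
qed

text \<open>Up to the factor \<open>q(v)\<close>, the action of \<open>v\<close> commutes with the cubic map \<open>x \<mapsto> x\<pi>(x)\<close>.
  Apply (D1) to the point \<open>xv\<close> and the vector \<open>v\<^sup>\<sigma>\<close>: since \<open>(xv)v\<^sup>\<sigma> = q(v)x\<close>, the value
  \<open>\<theta>(xv, v\<^sup>\<sigma>)\<close> reduces to \<open>\<theta>(x,v)\<close>.\<close>

lemma cube_act:
  "ac (ac x v) (pimap \<Omega> (ac x v)) = sX (q v) (ac (ac x (pimap \<Omega> x)) v)"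
proof (cases "v = 0")
  case False
  then have qv: "q v \<noteq> 0" using anisotropic by blast
  let ?y = "ac x v" and ?t = "thetamap \<Omega> x v" and ?p = "f (pimap \<Omega> x) v"
  have "thetamap \<Omega> ?y (sigma \<Omega> v) = sL (q v * (1 / 2)) (h ?y x)"
    by (simp add: C act_sigma hmap_scale_right)
  also have "h ?y x = h x ?y + sL (2 * ?p) e"
    using hmap_swap[of x ?y] B3[of x v x] two_nonzero by (simp add: f_bilin pimap_eq algebra_simps)
  finally have th: "thetamap \<Omega> ?y (sigma \<Omega> v) = sL (q v) (?t + sL ?p e)"
    using two_nonzero by (simp add: C L.scale_right_distrib mult.commute)
  have "ac (ac ?y (pimap \<Omega> ?y)) (sigma \<Omega> v) = sX (q v) (ac ?y ?t + sX ?p ?y)"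
    using D1[of ?y "sigma \<Omega> v"] by (simp add: th act_scale_right act_add_right A2)
  also have "\<dots> = sX (q v) (sX (q v) (ac x (pimap \<Omega> x)))"
    by (simp add: act_act_theta)
  finally have "ac (ac (ac ?y (pimap \<Omega> ?y)) (sigma \<Omega> v)) v
      = sX (q v) (sX (q v) (ac (ac x (pimap \<Omega> x)) v))"
    by (simp add: act_scale_left)
  then show ?thesis using qv by (simp only: act_sigma_act X.scale_cancel_left) simp
qed (simp add: act_zero_right act_zero_left q_zero)

lemma X_triple_add: "X_triple \<Omega> (x + x') y z = X_triple \<Omega> x y z + X_triple \<Omega> x' y z"
  by (simp add: X_triple_def bilin X.scale_right_distrib algebra_simps)

lemma X_triple_scale: "X_triple \<Omega> (sX c x) y z = sX c (X_triple \<Omega> x y z)"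
  by (simp add: X_triple_def bilin X.scale_right_distrib L.scale_right_distrib[symmetric] mult.commute)

lemma X_triple_comm: "X_triple \<Omega> x y z = X_triple \<Omega> y x z" "X_triple \<Omega> x y z = X_triple \<Omega> x z y"
  by (simp_all add: X_triple_def add_ac)

lemma X_triple_add': "X_triple \<Omega> x (y + y') z = X_triple \<Omega> x y z + X_triple \<Omega> x y' z"
  "X_triple \<Omega> x y (z + z') = X_triple \<Omega> x y z + X_triple \<Omega> x y z'"
  by (simp_all add: X_triple_def bilin X.scale_right_distrib algebra_simps)

lemma X_triple_scale': "X_triple \<Omega> x (sX c y) z = sX c (X_triple \<Omega> x y z)"
  "X_triple \<Omega> x y (sX c z) = sX c (X_triple \<Omega> x y z)"
  by (simp_all add: X_triple_def bilin X.scale_right_distrib L.scale_right_distrib[symmetric] mult.commute)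

lemmas X_triple_trilinear = X_triple_add X_triple_scale X_triple_add' X_triple_scale'

lemma X_triple_cube: "X_triple \<Omega> x x x = sX 6 (ac x (pimap \<Omega> x))"
proof -
  have "h x x + h x x = sL 2 (h x x)" using L.scale_left_distrib[of 1 1 "h x x"] by simp
  then have "X_triple \<Omega> x x x = sX (1/2) (sX 2 (ac x (h x x)) + sX 2 (ac x (h x x)) + sX 2 (ac x (h x x)))"
    by (simp add: X_triple_def act_scale_right)
  also have "\<dots> = ac x (h x x) + ac x (h x x) + ac x (h x x)"
    using two_nonzero by (simp add: X.scale_right_distrib)
  also have "\<dots> = sX (1 + 1 + 1) (ac x (h x x))" by (simp only: X.scale_left_distrib X.scale_one)
  finally show ?thesis using two_nonzero by (simp add: pimap_eq act_scale_right)
qed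

lemma X_triple_polarize:
  "sX 6 (X_triple \<Omega> x y z) = X_triple \<Omega> (x + y + z) (x + y + z) (x + y + z)
     - X_triple \<Omega> (x + y) (x + y) (x + y) - X_triple \<Omega> (x + z) (x + z) (x + z)
     - X_triple \<Omega> (y + z) (y + z) (y + z)
     + X_triple \<Omega> x x x + X_triple \<Omega> y y y + X_triple \<Omega> z z z"
proof -
  have six: "(6::'k) = 1 + 1 + 1 + 1 + 1 + 1" by simp
  let ?p = "X_triple \<Omega>"
  have c: "?p x z y = ?p x y z" "?p y x z = ?p x y z" "?p y z x = ?p x y z" "?p z x y = ?p x y z"
    "?p z y x = ?p x y z" "?p y x y = ?p x y y" "?p y y x = ?p x y y"  "?p x y x = ?p x x y" "?p y x x = ?p x x y"
    "?p z x x = ?p x x z" "?p x z x = ?p x x z" "?p z x z = ?p x z z" "?p z z x = ?p x z z"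
    "?p z y y = ?p y y z" "?p y z y = ?p y y z" "?p z y z = ?p y z z" "?p z z y = ?p y z z"
    by (simp_all add: X_triple_def add_ac)
  show ?thesis
    by (simp only: six X.scale_left_distrib X.scale_one X_triple_trilinear c) (simp add: algebra_simps)
qed

text \<open>The full linearisation of \<open>cube_act\<close>.\<close>

lemma X_triple_act:
  assumes "CHAR('k) \<noteq> 3"
  shows "X_triple \<Omega> (ac x v) (ac y v) (ac z v) = sX (q v) (ac (X_triple \<Omega> x y z) v)"
proof -
  have "(3::'k) \<noteq> 0" using of_nat_prime_nonzero[of 3] assms by simp
  then have six: "(6::'k) \<noteq> 0" using two_nonzero by (metis mult_2 mult_eq_0_iff numeral_Bit0)
  have cube: "X_triple \<Omega> (ac x v) (ac x v) (ac x v) = sX (q v) (ac (X_triple \<Omega> x x x) v)" for x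
    by (simp add: X_triple_cube cube_act act_scale_left mult.commute)
  have "sX 6 (X_triple \<Omega> (ac x v) (ac y v) (ac z v)) = sX (q v) (ac (sX 6 (X_triple \<Omega> x y z)) v)"
    unfolding X_triple_polarize
    by (simp only: act_add_left[symmetric] cube)
       (simp only: act_add_left act_diff_left X.scale_right_distrib X.scale_right_diff_distrib)
  also have "\<dots> = sX 6 (sX (q v) (ac (X_triple \<Omega> x y z) v))"
    by (simp add: act_scale_left mult.commute)
  finally show ?thesis using six by (simp only: X.scale_cancel_left) simp
qed

end

section \<open>The operators \<open>V\<close> of the algebras \<open>M(J,\<eta>)\<close>\<close>

text \<open>What the structure of \<open>M(J,\<eta>)\<close> depends on: a subspace \<open>J\<close> of an ambient vector space with a
  symmetric bilinear form \<open>T\<close> and a symmetric bilinear product \<open>X\<close>, the cross product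
  \<open>\<times>\<close>. Outside \<open>J\<close> nothing is assumed about \<open>T\<close> and \<open>X\<close>.\<close>

locale matrix_data = vector_space s
  for s :: "'d::field \<Rightarrow> 'w::ab_group_add \<Rightarrow> 'w" +
  fixes J :: "'w set" and T :: "'w \<Rightarrow> 'w \<Rightarrow> 'd" and X :: "'w \<Rightarrow> 'w \<Rightarrow> 'w"
  assumes subspace_J: "subspace J"
    and T_add: "\<lbrakk>x \<in> J; y \<in> J; z \<in> J\<rbrakk> \<Longrightarrow> T (x + y) z = T x z + T y z"
    and T_scale: "\<lbrakk>x \<in> J; z \<in> J\<rbrakk> \<Longrightarrow> T (s c x) z = c * T x z"
    and T_comm: "\<lbrakk>x \<in> J; y \<in> J\<rbrakk> \<Longrightarrow> T x y = T y x"
    and X_closed: "\<lbrakk>x \<in> J; y \<in> J\<rbrakk> \<Longrightarrow> X x y \<in> J"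
    and X_add: "\<lbrakk>x \<in> J; y \<in> J; z \<in> J\<rbrakk> \<Longrightarrow> X (x + y) z = X x z + X y z"
    and X_scale: "\<lbrakk>x \<in> J; z \<in> J\<rbrakk> \<Longrightarrow> X (s c x) z = s c (X x z)"
    and X_comm: "\<lbrakk>x \<in> J; y \<in> J\<rbrakk> \<Longrightarrow> X x y = X y x"
begin

lemma J_closed: "0 \<in> J" "\<lbrakk>x \<in> J; y \<in> J\<rbrakk> \<Longrightarrow> x + y \<in> J" "x \<in> J \<Longrightarrow> s c x \<in> J"
  "\<lbrakk>x \<in> J; y \<in> J\<rbrakk> \<Longrightarrow> x - y \<in> J"  "x \<in> J \<Longrightarrow> - x \<in> J"
  using subspace_J subspace_0 subspace_add subspace_scale subspace_diff subspace_neg by blast+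

lemma T_add': "\<lbrakk>x \<in> J; y \<in> J; z \<in> J\<rbrakk> \<Longrightarrow> T z (x + y) = T z x + T z y"
  and T_scale': "\<lbrakk>x \<in> J; z \<in> J\<rbrakk> \<Longrightarrow> T z (s c x) = c * T z x"
  and X_add': "\<lbrakk>x \<in> J; y \<in> J; z \<in> J\<rbrakk> \<Longrightarrow> X z (x + y) = X z x + X z y"
  and X_scale': "\<lbrakk>x \<in> J; z \<in> J\<rbrakk> \<Longrightarrow> X z (s c x) = s c (X z x)"
  by (simp_all add: T_comm[of z] X_comm[of z] T_add T_scale X_add X_scale J_closed)

lemma TX_zero: "x \<in> J \<Longrightarrow> T 0 x = 0" "x \<in> J \<Longrightarrow> T x 0 = 0" "x \<in> J \<Longrightarrow> X 0 x = 0" "x \<in> J \<Longrightarrow> X x 0 = 0"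
  using T_scale[of x x 0] T_scale'[of x x 0] X_scale[of x x 0] X_scale'[of x x 0] by auto

lemma TX_minus: "\<lbrakk>x \<in> J; z \<in> J\<rbrakk> \<Longrightarrow> T (- x) z = - T x z" "\<lbrakk>x \<in> J; z \<in> J\<rbrakk> \<Longrightarrow> T z (- x) = - T z x"
  "\<lbrakk>x \<in> J; z \<in> J\<rbrakk> \<Longrightarrow> X (- x) z = - X x z" "\<lbrakk>x \<in> J; z \<in> J\<rbrakk> \<Longrightarrow> X z (- x) = - X z x"
  using T_scale[of x z "-1"] T_scale'[of x z "-1"] X_scale[of x z "-1"] X_scale'[of x z "-1"] by auto

lemmas bil = T_add T_scale T_add' T_scale' X_add X_scale X_add' X_scale' TX_zero TX_minus J_closed
  X_closed

abbreviation "M \<equiv> matrix_alg s J T X"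

lemma amult_M: "amult (M \<eta>) (k\<^sub>1, j\<^sub>1, j\<^sub>2, k\<^sub>2) (l\<^sub>1, i\<^sub>1, i\<^sub>2, l\<^sub>2) =
       (k\<^sub>1 * l\<^sub>1 + \<eta> * T j\<^sub>1 i\<^sub>2,
        s k\<^sub>1 i\<^sub>1 + s l\<^sub>2 j\<^sub>1 + s \<eta> (X j\<^sub>2 i\<^sub>2),
        s l\<^sub>1 j\<^sub>2 + s k\<^sub>2 i\<^sub>2 + X j\<^sub>1 i\<^sub>1,
        k\<^sub>2 * l\<^sub>2 + \<eta> * T j\<^sub>2 i\<^sub>1)"
  and aconj_M: "aconj (M \<eta>) (k\<^sub>1, j\<^sub>1, j\<^sub>2, k\<^sub>2) = (k\<^sub>2, j\<^sub>1, j\<^sub>2, k\<^sub>1)"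
  and ascale_M: "ascale (M \<eta>) c (k\<^sub>1, j\<^sub>1, j\<^sub>2, k\<^sub>2) = (c * k\<^sub>1, s c j\<^sub>1, s c j\<^sub>2, c * k\<^sub>2)"
  and acarrier_M: "acarrier (M \<eta>) = UNIV \<times> J \<times> J \<times> UNIV"
  and aone_M: "aone (M \<eta>) = (1, 0, 0, 1)"
  by (simp_all add: matrix_alg_def)

text \<open>Multiplying the upper left entry by \<open>\<eta>\<close> carries the operators \<open>V\<close> of \<open>M(J,1)\<close> to
  operators \<open>V\<close> of \<open>M(J,\<eta>)\<close>, up to a diagonal change of the middle argument. Conceptually, if
  \<open>\<mu>\<^sup>3 = \<eta>\<close>, then \<open>(k\<^sub>1, j\<^sub>1, j\<^sub>2, k\<^sub>2) \<mapsto> (k\<^sub>1, \<mu>j\<^sub>1, \<mu>\<^sup>2j\<^sub>2, k\<^sub>2)\<close> is an isomorphism of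
  \<open>M(J,\<eta>)\<close> onto \<open>M(J,1)\<close>, and the rescaling agrees with it up to a similarity of the Freudenthal
  triple system. The identity itself is polynomial and only needs bilinearity and
  symmetry.\<close>

lemma V_rescale:
  assumes "j\<^sub>1 \<in> J" "j\<^sub>2 \<in> J" "i\<^sub>1 \<in> J" "i\<^sub>2 \<in> J" "n\<^sub>1 \<in> J" "n\<^sub>2 \<in> J"
  shows "V_op (M \<eta>) (\<eta> * k\<^sub>1, j\<^sub>1, j\<^sub>2, k\<^sub>2) (l\<^sub>1, i\<^sub>1, i\<^sub>2, l\<^sub>2) (\<eta> * m\<^sub>1, n\<^sub>1, n\<^sub>2, m\<^sub>2) =
    apfst ((*) \<eta>) (V_op (M 1) (k\<^sub>1, j\<^sub>1, j\<^sub>2, k\<^sub>2) (l\<^sub>1, s \<eta> i\<^sub>1, s \<eta> i\<^sub>2, \<eta> * l\<^sub>2) (m\<^sub>1, n\<^sub>1, n\<^sub>2, m\<^sub>2))"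
  using assms
  apply (simp add: V_op_def amult_M aconj_M bil scale_right_distrib scale_left_distrib
    scale_right_diff_distrib)
  \<comment> \<open>One goal for each of the four matrix entries.\<close>
  apply (intro conjI)
  subgoal by (simp add: ring_distribs ac_simps)
  subgoal by (simp add: scale_left_distrib X_comm ring_distribs mult_ac)
  subgoal by (simp add: scale_left_distrib X_comm ring_distribs mult_ac)
  subgoal by (simp add: ring_distribs ac_simps)
  done

lemma alg_form_M:
  assumes "j\<^sub>1 \<in> J" "j\<^sub>2 \<in> J" "i\<^sub>1 \<in> J" "i\<^sub>2 \<in> J"
  shows "alg_form (M 1) (1, 0, 0, - 1) (k\<^sub>1, j\<^sub>1, j\<^sub>2, k\<^sub>2) (l\<^sub>1, i\<^sub>1, i\<^sub>2, l\<^sub>2) =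
    k\<^sub>1 * l\<^sub>2 - l\<^sub>1 * k\<^sub>2 + T j\<^sub>1 i\<^sub>2 - T j\<^sub>2 i\<^sub>1"
  unfolding alg_form_def
  using assms
  by (intro the_equality) (auto simp add: amult_M aconj_M aone_M ascale_M bil X_comm T_comm algebra_simps)

text \<open>The cross product is recovered from the Freudenthal triple product of \<open>M(J,1)\<close>.\<close>

lemma cross_as_triple:
  assumes "i \<in> J" "j \<in> J"
  shows "alg_triple (M 1) (1, 0, 0, - 1) (0, i, 0, 0) (0, j, 0, 0) (c, 0, 0, 0) = (0, 0, s (2 * c) (X i j), 0)"
   "alg_triple (M 1) (1, 0, 0, - 1) (0, 0, i, 0) (0, 0, j, 0) (0, 0, 0, c) = (0, s (- (2 * c)) (X i j), 0, 0)"
  using assms by (simp_all add: alg_triple_def alg_form_M V_op_def amult_M aconj_M ascale_M bil X_comm zero_prod_def)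

end

lemma matrix_data_quadratic:
  assumes "vector_space s" "module.subspace s J" "jordan_quadratic s J T X"
  shows "matrix_data s J T X"
proof -
  interpret vector_space s by fact
  obtain Q where Q: "quadratic_form_on s J Q" "\<And>x y. x \<in> J \<Longrightarrow> y \<in> J \<Longrightarrow> T x y = polar Q x y"
    and X: "\<And>x y. x \<in> J \<Longrightarrow> y \<in> J \<Longrightarrow> X x y = 0"
    using assms(3) unfolding jordan_quadratic_def by blast
  note cl = subspace_0[OF assms(2)] subspace_add[OF assms(2)] subspace_scale[OF assms(2)]
  show ?thesis
    using Q by unfold_locales (auto simp: cl X assms(2) polar_comm quadratic_form_on_def bilinear_form_on_def linear_on_def)
qed

lemma cubic_polar_comm:
  "cubic_polar N x y z = cubic_polar N y x z" "cubic_polar N x y z = cubic_polar N x z y"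
  by (simp_all add: cubic_polar_def algebra_simps)

text \<open>For an admissible cubic form \<open>N\<close>, \<open>T(x \<times> y, z) = N(x;y,z)\<close>; bilinearity of \<open>\<times>\<close> then
  follows from that of the right hand side, as \<open>T\<close> is nondegenerate.\<close>

lemma matrix_data_cubic:
  assumes "vector_space s" "module.subspace s J" "jordan_cubic s J N e T X" and two: "(2::'d::field) \<noteq> 0"
  shows "matrix_data (s :: 'd \<Rightarrow> 'w::ab_group_add \<Rightarrow> 'w) J T X"
proof -
  interpret vector_space s by fact
  obtain sh where "admissible_cubic s J N e sh"
    and TN: "\<And>x y. x \<in> J \<Longrightarrow> y \<in> J \<Longrightarrow> T x y = cubic_trace N e x y"
    and Xsh: "\<And>x y. x \<in> J \<Longrightarrow> y \<in> J \<Longrightarrow> X x y = sh (x + y) - sh x - sh y"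
    using assms(3) unfolding jordan_cubic_def by blast
  then have cf: "cubic_form_on s J N" and e: "e \<in> J" and nd: "nondegenerate_on J (cubic_trace N e)"
    and sh: "\<And>x. x \<in> J \<Longrightarrow> sh x \<in> J"
    and shT: "\<And>x y. x \<in> J \<Longrightarrow> y \<in> J \<Longrightarrow> cubic_trace N e (sh x) y = cubic_deriv N x y"
    unfolding admissible_cubic_def by auto
  note cl = subspace_0[OF assms(2)] subspace_add[OF assms(2)] subspace_scale[OF assms(2)]
     subspace_diff[OF assms(2)]
  let ?c = "cubic_polar N"
  have c1: "?c (x + x') y z = ?c x y z + ?c x' y z" "?c (s r x) y z = r * ?c x y z"
    if "x \<in> J" "x' \<in> J" "y \<in> J" "z \<in> J" for x x' y z r
    using cf that unfolding cubic_form_on_def linear_on_def by blast+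
  have c2: "?c y (x + x') z = ?c y x z + ?c y x' z" "?c y (s r x) z = r * ?c y x z"
     "?c y z (x + x') = ?c y z x + ?c y z x'"  "?c y z (s r x) = r * ?c y z x"
    if "x \<in> J" "x' \<in> J" "y \<in> J" "z \<in> J" for x x' y z r
    using c1[OF that] cubic_polar_comm[of N] by metis+
  have T1: "T (x + y) z = T x z + T y z" "T (s r x) z = r * T x z" "T x z = T z x"
    if "x \<in> J" "y \<in> J" "z \<in> J" for x y z r
    using that e by (simp_all add: TN cl cubic_trace_def cubic_deriv_def c1 c2 cubic_polar_comm(2)[of N e x z] algebra_simps)
  have T2: "T (x - y) z = T x z - T y z"
    if "x \<in> J" "y \<in> J" "z \<in> J" for x y z
    using T1(1)[of "x - y" y z] that cl by simp
  have Xc: "X x y \<in> J" if "x \<in> J" "y \<in> J" for x y using that by (simp add: Xsh sh cl)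
  have TX: "T (X x y) z = ?c x y z" if "x \<in> J" "y \<in> J" "z \<in> J" for x y z
  proof -
    have "T (X x y) z = cubic_deriv N (x + y) z - cubic_deriv N x z - cubic_deriv N y z"
      using that by (simp add: Xsh T2 sh cl) (simp add: TN sh cl shT)
    also have "\<dots> = (1 / 2) * (2 * ?c x y z)"
      using that by (simp add: cubic_deriv_def c1 c2 cl cubic_polar_comm(1)[of N y x] algebra_simps)
    finally show ?thesis using two by simp
  qed
  have eqI: "u = w" if "u \<in> J" "w \<in> J" "\<And>z. z \<in> J \<Longrightarrow> T u z = T w z" for u w
  proof -
    have "\<forall>z\<in>J. cubic_trace N e (u - w) z = 0"
      using that by (simp add: TN[symmetric] cl T2)
    then have "u - w = 0" using nd that cl unfolding nondegenerate_on_def by blast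
    then show ?thesis by simp
  qed
  show ?thesis
  proof
    show "subspace J" by fact
    show "X (x + y) z = X x z + X y z" if "x \<in> J" "y \<in> J" "z \<in> J" for x y z
      by (rule eqI) (use that in \<open>simp_all add: Xc cl T1(1) TX c1\<close>)
    show "X (s r x) z = s r (X x z)" if "x \<in> J" "z \<in> J" for x z r
      by (rule eqI) (use that in \<open>simp_all add: Xc cl T1(2) TX c1\<close>)
    show "X x y = X y x" if "x \<in> J" "y \<in> J" for x y
      by (rule eqI) (use that cubic_polar_comm[of N] in \<open>simp_all add: Xc TX\<close>)
  qed (use T1 Xc in blast)+
qed

section \<open>The triple system \<open>X \<otimes> \<Delta>\<close> and its semilinear automorphism\<close>

context X_construction
begin

text \<open>Scalar multiplication by \<open>\<Delta>\<close> on \<open>X \<otimes> \<Delta>\<close> is \<open>sW\<close>, and \<open>m\<close> is the element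
  \<open>\<delta>\<^sup>2\<close> of \<open>K\<close>.\<close>

abbreviation "E \<equiv> emb C"
abbreviation "D \<equiv> delta C"
abbreviation "\<iota> \<equiv> iota C"
abbreviation "m \<equiv> - qform \<Omega> (pimap \<Omega> (pt C))"
abbreviation "sW \<equiv> scaleW \<Omega> C"

lemma emb_zero: "E 0 = 0"
  using emb_add[of 0 0] by (simp only: add_0_left add_cancel_right_right)

lemma emb_minus: "E (- r) = - E r"
  using emb_add[of r "- r"] minus_unique[of "E r" "E (- r)"] by (simp add: emb_zero)

lemma emb_diff: "E (r - s) = E r - E s"
  using emb_add[of r "- s"] by (simp add: emb_minus)

lemma emb_nonzero: "r \<noteq> 0 \<Longrightarrow> E r \<noteq> 0"
  using emb_mult[of r "1 / r"] emb_one by auto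

lemma emb_inj: "E r = E s \<longleftrightarrow> r = s"
  using emb_nonzero[of "r - s"] emb_add[of "r - s" s] by auto

lemma emb_divide: "E (r / s) = E r / E s"
proof (cases "s = 0")
  case False
  then show ?thesis using emb_mult[of "r / s" s] emb_nonzero[of s] by (simp add: field_simps)
qed (simp add: emb_zero)

lemma emb_two: "E 2 = 2"
  using emb_add[of 1 1] by (simp add: emb_one)

lemma two_nonzero_D: "(2::'d) \<noteq> 0"
  using emb_nonzero[OF two_nonzero] by (simp add: emb_two)

lemma D_nonzero: "D \<noteq> 0"
  using delta_not_in_K emb_zero by (metis rangeI)

lemma D_square: "D * D = E m"
  using delta_sq by (simp add: emb_minus power2_eq_square)

lemma coords_eq: "coords C (E r + E s * D) = (r, s)"
proof -
  have *: "s = s'" if "E r + E s * D = E r' + E s' * D" for r s r' s'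
  proof (rule ccontr)
    assume n: "s \<noteq> s'"
    have "E (s - s') * D = E (r' - r)"
      using that emb_add[of "s - s'" s'] emb_add[of "r' - r" r] by (simp add: algebra_simps)
    then have "D = E ((r' - r) / (s - s'))"
      using n emb_nonzero[of "s - s'"] by (simp add: emb_divide field_simps)
    then show False using delta_not_in_K by blast
  qed
  then have "inj (\<lambda>(r, s). E r + E s * D)"
    unfolding inj_on_def using * emb_inj by fastforce
  from the_inv_f_f[OF this, of "(r, s)"] show ?thesis by (simp add: coords_def)
qed

lemma scaleW_eq: "sW (E r + E s * D) (x, y) = (sX r x + sX (s * m) y, sX r y + sX s x)"
  by (simp add: scaleW_def coords_eq)

lemma scaleW_emb: "sW (E r) (x, y) = (sX r x, sX r y)"
  using scaleW_eq[of r 0 x y] by (simp add: emb_zero)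

lemma scaleW_D: "sW (E s * D) (x, y) = (sX (s * m) y, sX s x)"
  using scaleW_eq[of 0 s x y] by (simp add: emb_zero)

lemma scaleW_delta: "sW D (x, y) = (sX m y, x)"
  using scaleW_D[of 1 x y] by (simp add: emb_one)

sublocale W: vector_space sW
proof
  fix c d :: 'd and w w' :: "'x \<times> 'x"
  obtain r s r' s' where c: "c = E r + E s * D" and d: "d = E r' + E s' * D"
    using Delta_generated by metis
  obtain x y x' y' where w: "w = (x, y)" "w' = (x', y')" by (cases w, cases w')
  show "sW c (w + w') = sW c w + sW c w'"
    by (simp add: c w scaleW_eq X.scale_right_distrib add_ac)
  have "c + d = E (r + r') + E (s + s') * D" by (simp add: c d emb_add algebra_simps)
  then show "sW (c + d) w = sW c w + sW d w"
    by (simp only: c d w scaleW_eq) (simp add: X.scale_left_distrib algebra_simps)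
  have "c * d = E r * E r' + (E r * E s' + E s * E r') * D + E s * E s' * (D * D)"
    by (simp add: c d algebra_simps)
  then have "c * d = E (r * r' + s * s' * m) + E (r * s' + s * r') * D"
    by (simp add: D_square emb_add emb_mult emb_minus emb_diff algebra_simps)
  then show "sW c (sW d w) = sW (c * d) w"
    by (simp only: c d w scaleW_eq)
      (simp add: X.scale_left_distrib X.scale_right_distrib X.scale_minus_right algebra_simps)
  show "sW 1 w = w"
    using scaleW_emb[of 1] by (simp add: w emb_one)
qed

lemma iota_zero: "\<iota> 0 = 0"
  using iota_emb[of 0] by (simp add: emb_zero)

lemma iota_one: "\<iota> 1 = 1"
  using iota_emb[of 1] by (simp add: emb_one)

lemma iota_minus: "\<iota> (- d) = - \<iota> d"
  using iota_add[of d "- d"] by (simp add: iota_zero eq_neg_iff_add_eq_0 add.commute)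

lemma iota_diff: "\<iota> (c - d) = \<iota> c - \<iota> d"
  using iota_add[of c "- d"] by (simp add: iota_minus)

lemma iota_eq_zero: "\<iota> d = 0 \<longleftrightarrow> d = 0"
  using bij_is_inj[OF iota_bij] iota_zero by (metis injD)

lemma iota_divide: "\<iota> (c / d) = \<iota> c / \<iota> d"
proof (cases "d = 0")
  case False
  then show ?thesis using iota_mult[of "c / d" d] iota_eq_zero[of d] by (simp add: field_simps)
qed (simp add: iota_zero)

lemma iota_two: "\<iota> 2 = 2"
  using iota_emb[of 2] by (simp add: emb_two)

lemma iota_D: "\<iota> D = - D"
proof -
  have "\<iota> D * \<iota> D = D * D"
    by (simp add: iota_mult[symmetric] D_square iota_emb del: minus_mult_left)
  moreover have "\<iota> D \<noteq> D"
  proof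
    assume "\<iota> D = D"
    then have "\<iota> d = d" for d
      using Delta_generated[of d] by (auto simp: iota_add iota_mult iota_emb)
    then show False using iota_nontrivial by (auto simp: fun_eq_iff)
  qed
  ultimately show ?thesis by (simp add: square_eq_iff)
qed

lemma iota_iota: "\<iota> (\<iota> d) = d"
  using Delta_generated[of d] by (auto simp: iota_add iota_mult iota_emb iota_D iota_minus iota_diff)

text \<open>\<open>et\<close> is the map \<open>x \<otimes> d \<mapsto> x \<otimes> \<iota>(d)\<close>. In the coordinates \<open>(x, y)\<close> for \<open>x \<otimes> 1 + y \<otimes> \<delta>\<close>
  it changes the sign of \<open>y\<close>, so that its fixed points are the elements of \<open>X\<close>.\<close>

abbreviation "et \<equiv> eta_tilde \<Omega> C"

lemma et_eq: "et (x, y) = (x, - y)"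
proof -
  have "sW (- D) (y, 0) = (0, - y)"
    using scaleW_D[of "- 1" y 0] by (simp add: emb_minus emb_one del: W.scale_minus_left)
  then show ?thesis by (simp add: eta_tilde_def iota_D inc_def del: W.scale_minus_left)
qed

lemma et_inc: "et (inc x) = inc x"
  by (simp add: inc_def et_eq)

lemma et_fixed: assumes "et w = w" obtains x where "w = inc x"
proof -
  obtain x y where w: "w = (x, y)" by (cases w)
  then have "y + y = 0" using assms by (simp add: et_eq neg_eq_iff_add_eq_0)
  then have "sX 2 y = 0" using X.scale_left_distrib[of 1 1 y] by simp
  then show ?thesis using that[of x] w two_nonzero by (simp add: inc_def)
qed

lemma et_et: "et (et w) = w"
  by (cases w) (simp add: et_eq)

lemma et_add: "et (w + w') = et w + et w'"
  by (cases w, cases w') (simp add: et_eq)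

lemma et_minus: "et (- w) = - et w"
  by (cases w) (simp add: et_eq)

lemma et_scale: "et (sW d w) = sW (\<iota> d) (et w)"
proof -
  obtain r s where d: "d = E r + E s * D" using Delta_generated by metis
  then have "\<iota> d = E r + E (- s) * D"
    by (simp add: iota_add iota_mult iota_emb iota_D emb_minus)
  then show ?thesis
    by (cases w) (simp only: d scaleW_eq et_eq, simp add: X.scale_minus_left X.scale_minus_right)
qed

abbreviation "p \<equiv> X_triple \<Omega>"
abbreviation "W3 \<equiv> W_triple \<Omega> C"
abbreviation "WF \<equiv> W_form \<Omega> C"

lemma W_triple_eq:
  "W3 (x\<^sub>0, x\<^sub>1) (y\<^sub>0, y\<^sub>1) (z\<^sub>0, z\<^sub>1) =
    (p x\<^sub>0 y\<^sub>0 z\<^sub>0 + sX m (p x\<^sub>1 y\<^sub>1 z\<^sub>0 + p x\<^sub>1 y\<^sub>0 z\<^sub>1 + p x\<^sub>0 y\<^sub>1 z\<^sub>1),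
     p x\<^sub>1 y\<^sub>0 z\<^sub>0 + p x\<^sub>0 y\<^sub>1 z\<^sub>0 + p x\<^sub>0 y\<^sub>0 z\<^sub>1 + sX m (p x\<^sub>1 y\<^sub>1 z\<^sub>1))"
proof -
  have "D ^ 2 = E m" "D ^ 3 = E m * D"
    using D_square by (simp_all add: power2_eq_square power3_eq_cube)
  then show ?thesis
    by (simp only: W_triple_def Let_def case_prod_conv scaleW_emb scaleW_D scaleW_delta inc_def)
      simp
qed

lemma X_triple_minus: "p (- x) y z = - p x y z" "p x (- y) z = - p x y z" "p x y (- z) = - p x y z"
  using X_triple_scale[of "- 1" x y z] X_triple_scale'(1)[of x "- 1" y z] X_triple_scale'(2)[of x y "- 1" z]
  by (simp_all add: X.scale_minus_left)

lemma et_W_triple: "et (W3 x y z) = W3 (et x) (et y) (et z)"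
  by (cases x, cases y, cases z)
    (simp add: W_triple_eq et_eq X_triple_minus X.scale_minus_right algebra_simps)

lemma gform_bilin: "g (x + x') y = g x y + g x' y" "g x (y + y') = g x y + g x y'"
   "g (sX c x) y = c * g x y" "g x (sX c y) = c * g x y"
  by (simp_all add: gform_def bilin f_bilin algebra_simps)

lemma gform_minus: "g (- x) y = - g x y" "g x (- y) = - g x y"
  using gform_bilin(3)[of "- 1" x y] gform_bilin(4)[of x "- 1" y] by (simp_all add: X.scale_minus_left)

lemma et_W_form: "WF (et x) (et y) = \<iota> (WF x y)"
  by (cases x, cases y)
    (simp add: W_form_def Let_def et_eq gform_minus iota_add iota_mult iota_emb iota_D emb_add emb_minus
      power2_eq_square algebra_simps)

lemma W_form_inc: "WF (inc x) (inc y) = E (g x y)"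
proof -
  have "g 0 y = 0" "g x 0 = 0" "g 0 0 = 0"
    using gform_bilin(3)[of 0 x y] gform_bilin(4)[of x 0 y] gform_bilin(3)[of 0 0 0] by simp_all
  then show ?thesis by (simp add: W_form_def inc_def emb_zero Let_def)
qed

lemma W_triple_inc: "W3 (inc x) (inc y) (inc z) = inc (p x y z)"
  using X_triple_scale[of 0] X_triple_scale'[of _ 0]  X_triple_scale'(2)[of _ _ 0] by (simp add: inc_def W_triple_eq)

lemma W_triple_scale: "W3 (sW d x) y z = sW d (W3 x y z)"
proof -
  obtain r s where d: "d = E r + E s * D" using Delta_generated by metis
  show ?thesis
    by (cases x, cases y, cases z) (simp only: d scaleW_eq W_triple_eq X_triple_trilinear,
      simp add: X.scale_right_distrib X.scale_minus_right algebra_simps)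
qed

lemma W_triple_comm: "W3 x y z = W3 y x z" "W3 x y z = W3 x z y"
proof -
  obtain x0 x1 y0 y1 z0 z1 where w: "x = (x0, x1)" "y = (y0, y1)" "z = (z0, z1)"
    by (cases x, cases y, cases z)
  note c = X_triple_comm(1)[of x0 y0] X_triple_comm(1)[of x0 y1] X_triple_comm(1)[of x1 y0] X_triple_comm(1)[of x1 y1]
   X_triple_comm(2)[of _ y0 z0] X_triple_comm(2)[of _ y0 z1] X_triple_comm(2)[of _ y1 z0] X_triple_comm(2)[of _ y1 z1]
  show "W3 x y z = W3 y x z" unfolding w W_triple_eq c(1-4) by (simp add: add_ac)
  show "W3 x y z = W3 x z y" unfolding w W_triple_eq c(5-8) by (simp add: add_ac)
qed

lemma W_triple_scale2: "W3 x (sW d y) z = sW d (W3 x y z)"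
  using W_triple_comm(1)[of x "sW d y" z] W_triple_scale[of d y x z] W_triple_comm(1)[of y x z]
  by (elim trans) (rule arg_cong)

lemma W_triple_scale3: "W3 x y (sW d z) = sW d (W3 x y z)"
  using W_triple_comm(2)[of x y "sW d z"] W_triple_scale2[of x d z y] W_triple_comm(2)[of x z y]
  by (elim trans) (rule arg_cong)

lemma W_triple_add: "W3 x y (z + z') = W3 x y z + W3 x y z'"
  by (cases x, cases y, cases z, cases z')
    (simp add: W_triple_eq X_triple_trilinear X.scale_right_distrib add_ac)

end

section \<open>The automorphism \<open>\<pi>~\<close> of \<open>M(J,\<eta>)\<close>\<close>

context X_construction
begin

abbreviation "l \<equiv> lam \<Omega> C"
abbreviation "N \<equiv> N_lam \<Omega> C"
abbreviation "\<eta> \<equiv> D / N"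
abbreviation "M1 \<equiv> M_eps \<Omega> C 1"
abbreviation "T \<equiv> traceJ C"
abbreviation "cr \<equiv> crossJ C"
abbreviation "t \<equiv> tmap C"
abbreviation "asm \<equiv> assemble \<Omega> C"
abbreviation "mat \<equiv> to_matrix \<Omega> C"

lemma lam_nonzero: "l \<noteq> 0"
  using e0_choice two_nonzero_D by (simp add: lam_def)

lemma N_nonzero: "N \<noteq> 0"
  using lam_nonzero by (simp add: N_lam_def iota_eq_zero)

lemma iota_N: "\<iota> N = N"
  by (simp add: N_lam_def iota_mult iota_iota mult.commute)

lemma eta_nonzero: "\<eta> \<noteq> 0"
  using D_nonzero N_nonzero by simp

lemma iota_eta: "\<iota> \<eta> = - \<eta>"
  by (simp add: iota_divide iota_N iota_D)

lemma et_u1': "et (u1' \<Omega> C) = sW (- D) (u2' \<Omega> C)"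
  using D_nonzero two_nonzero_D
  by (simp add: u1'_def u2'_def et_scale et_add et_inc et_minus iota_divide iota_one iota_two iota_D
    iota_mult W.scale_right_distrib W.scale_right_diff_distrib divide_simps)

lemma et_u2': "et (u2' \<Omega> C) = sW (1 / D) (u1' \<Omega> C)"
proof -
  have "u1' \<Omega> C = sW D (et (u2' \<Omega> C))"
    using arg_cong[OF et_u1', of et] by (simp add: et_et et_scale iota_minus iota_D et_minus)
  then show ?thesis using D_nonzero by simp
qed

lemma et_u1: "et (u1 \<Omega> C) = sW (- \<eta>) (u2 \<Omega> C)"
  using lam_nonzero
  by (simp add: u1_def u2_def et_scale et_u1' iota_divide iota_one N_lam_def iota_eq_zero divide_simps)

lemma et_u2: "et (u2 \<Omega> C) = sW (1 / \<eta>) (u1 \<Omega> C)"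
  using lam_nonzero
  by (simp add: u1_def u2_def et_scale et_u2' N_lam_def iota_eq_zero divide_simps mult.commute)

lemma M_eps_subspace: "W.subspace (M_eps \<Omega> C \<epsilon>)"
  using W_triple_scale3[of _ _ 0 0]
  by (auto simp: W.subspace_def M_eps_def W_triple_add W_triple_scale3 W.scale_right_distrib mult.commute)

text \<open>For \<open>\<epsilon> = 1\<close> and \<open>\<epsilon> = -1\<close> this says that \<open>et\<close> interchanges \<open>M\<^sub>1\<close> and \<open>M\<^sub>-\<^sub>1\<close>.\<close>

lemma et_M_eps:
  assumes "w \<in> M_eps \<Omega> C \<epsilon>"
  shows "et w \<in> M_eps \<Omega> C (- \<iota> \<epsilon>)"
proof -
  have "W3 (u1' \<Omega> C) (u2' \<Omega> C) (et w) = et (W3 (et (u1' \<Omega> C)) (et (u2' \<Omega> C)) w)"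
    by (simp add: et_W_triple et_et)
  also have "W3 (et (u1' \<Omega> C)) (et (u2' \<Omega> C)) w = sW (1 / D * - D) (W3 (u2' \<Omega> C) (u1' \<Omega> C) w)"
    by (simp only: et_u1' et_u2' W_triple_scale W_triple_scale2 W.scale_scale)
  also have "\<dots> = - sW \<epsilon> w"
    using assms D_nonzero W_triple_comm(1)[of "u2' \<Omega> C" "u1' \<Omega> C" w] by (simp add: M_eps_def)
  finally show ?thesis by (simp add: M_eps_def et_minus et_scale)
qed

sublocale MD: matrix_data sW M1 T cr
proof (cases "first_case \<Omega> C")
  case True
  show "matrix_data sW M1 T cr"
    by (rule matrix_data_quadratic[OF W.vector_space_axioms M_eps_subspace J_first[OF True]])
next
  case False
  show "matrix_data sW M1 T cr"
    by (rule matrix_data_cubic[OF W.vector_space_axioms M_eps_subspace J_second[OF False] two_nonzero_D])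
qed

abbreviation "Mat \<equiv> MD.M"
abbreviation "\<sigma> \<equiv> (1, 0, 0, - 1) :: ('d, 'x \<times> 'x) jmat"

lemma MJ_eq: "MJ \<Omega> C c = Mat c"
  by (simp add: MJ_def)

abbreviation "carr \<equiv> UNIV \<times> M1 \<times> M1 \<times> UNIV :: ('d, 'x \<times> 'x) jmat set"

lemma mat_asm: "w \<in> carr \<Longrightarrow> mat (asm w) = w"
  using decomposition
  by (simp add: MJ_eq MD.acarrier_M to_matrix_def bij_betw_def the_inv_into_f_f)

lemma asm_mat: "asm (mat w) = w"
  using decomposition
  by (simp add: MJ_eq MD.acarrier_M to_matrix_def bij_betw_def f_the_inv_into_f)

lemma mat_carr: "mat w \<in> carr"
  using decomposition the_inv_into_into[of asm carr w carr]
  by (simp add: MJ_eq MD.acarrier_M to_matrix_def bij_betw_def)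

lemma mat_add: "mat (w + w') = mat w + mat w'"
  and mat_scale: "mat (sW c w) = ascale (Mat 1) c (mat w)"
  and mat_form: "alg_form (Mat 1) \<sigma> (mat w) (mat w') = WF w w'"
  and mat_triple: "mat (W3 w w' w'') = alg_triple (Mat 1) \<sigma> (mat w) (mat w') (mat w'')"
  using isometry by (simp_all add: fts_isometry_def linear_on_def W_fts_def alg_fts_def MJ_eq del: split_paired_All)

text \<open>\<open>\<alpha> = t\<^sup>-\<^sup>1 \<circ> et\<close> and \<open>\<beta> = et \<circ> t\<close> are mutually inverse \<open>\<iota>\<close>-semilinear bijections of \<open>M\<^sub>1\<close>, the
  entries of \<open>et\<close> in matrix coordinates.\<close>

abbreviation "\<alpha> \<equiv> \<lambda>j. the_inv_into M1 t (et j)"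
abbreviation "\<beta> \<equiv> \<lambda>j. et (t j)"

lemma t_M1: "j \<in> M1 \<Longrightarrow> t j \<in> M_eps \<Omega> C (- 1)"
  using t_bij by (auto simp: bij_betw_def)

lemma be_M1: "j \<in> M1 \<Longrightarrow> \<beta> j \<in> M1"
  using et_M_eps[OF t_M1] by (simp add: iota_minus iota_one)

lemma et_in: "j \<in> M1 \<Longrightarrow> et j \<in> t ` M1"
  using et_M_eps[of j 1] t_bij by (simp add: iota_one bij_betw_def)

lemma al_M1: "j \<in> M1 \<Longrightarrow> \<alpha> j \<in> M1"
  using the_inv_into_into[of t M1 "et j" M1] et_in t_bij by (simp add: bij_betw_def)

lemma t_al: "j \<in> M1 \<Longrightarrow> t (\<alpha> j) = et j"
  using f_the_inv_into_f[of t M1 "et j"] et_in t_bij by (simp add: bij_betw_def)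

lemma be_al: "j \<in> M1 \<Longrightarrow> \<beta> (\<alpha> j) = j"
  by (simp add: t_al et_et)

lemma al_be: "j \<in> M1 \<Longrightarrow> \<alpha> (\<beta> j) = j"
  using the_inv_into_f_f[of t M1 j] t_bij by (simp add: et_et bij_betw_def)

lemma be_add: "\<lbrakk>i \<in> M1; j \<in> M1\<rbrakk> \<Longrightarrow> \<beta> (i + j) = \<beta> i + \<beta> j"
  and be_scale: "j \<in> M1 \<Longrightarrow> \<beta> (sW c j) = sW (\<iota> c) (\<beta> j)"
  using t_linear by (simp_all add: linear_on_def et_add et_scale)

lemma al_add: assumes "i \<in> M1" "j \<in> M1" shows "\<alpha> (i + j) = \<alpha> i + \<alpha> j"
  using assms be_add[of "\<alpha> i" "\<alpha> j"] al_be[of "\<alpha> i + \<alpha> j"] by (simp add: al_M1 be_al MD.J_closed)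

lemma al_scale: assumes "j \<in> M1" shows "\<alpha> (sW c j) = sW (\<iota> c) (\<alpha> j)"
  using assms be_scale[of "\<alpha> j" "\<iota> c"] al_be[of "sW (\<iota> c) (\<alpha> j)"]
  by (simp add: al_M1 be_al MD.J_closed iota_iota)

text \<open>\<open>phi\<close> is the map \<open>et\<close> in matrix coordinates, as \<open>mat_et\<close> confirms. It is a semilinear
  automorphism of the Freudenthal triple system of \<open>M(J,1)\<close>.\<close>

definition phi :: "('d, 'x \<times> 'x) jmat \<Rightarrow> ('d, 'x \<times> 'x) jmat"
  where "phi = (\<lambda>(d\<^sub>1, j\<^sub>1, j\<^sub>2, d\<^sub>2). (\<iota> d\<^sub>2 / \<eta>, \<beta> j\<^sub>2, \<alpha> j\<^sub>1, - \<eta> * \<iota> d\<^sub>1))"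

lemma phi_carr: "w \<in> carr \<Longrightarrow> phi w \<in> carr"
  by (auto simp: phi_def al_M1 be_M1)

lemma et_asm: "w \<in> carr \<Longrightarrow> et (asm w) = asm (phi w)"
  by (auto simp: phi_def assemble_def et_add et_scale et_u1 et_u2 t_al mult.commute add_ac)

lemma mat_et: "mat (et w) = phi (mat w)"
  using et_asm[OF mat_carr, of w] mat_asm[OF phi_carr[OF mat_carr], of w] by (simp add: asm_mat)

lemma phi_form:
  assumes "x \<in> carr" "y \<in> carr"
  shows "alg_form (Mat 1) \<sigma> (phi x) (phi y) = \<iota> (alg_form (Mat 1) \<sigma> x y)"
  using mat_form[of "et (asm x)" "et (asm y)"] mat_form[of "asm x" "asm y"] assms
  by (simp add: mat_et mat_asm et_W_form)

lemma phi_triple: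
  assumes "x \<in> carr" "y \<in> carr" "z \<in> carr"
  shows "phi (alg_triple (Mat 1) \<sigma> x y z) = alg_triple (Mat 1) \<sigma> (phi x) (phi y) (phi z)"
  using mat_triple[of "asm x" "asm y" "asm z"]
     mat_triple[of "et (asm x)" "et (asm y)" "et (asm z)"] assms
  by (simp add: mat_et mat_asm et_W_triple[symmetric])

lemma be_zero: "\<beta> 0 = 0" and al_zero: "\<alpha> 0 = 0"
  using be_scale[of 0 0] al_scale[of 0 0] by (simp_all add: iota_zero MD.J_closed)

lemma T_be_al:
  assumes "i \<in> M1" "j \<in> M1"
  shows "T (\<beta> j) (\<alpha> i) = - \<iota> (T j i)"
  using phi_form[of "(0, 0, j, 0)" "(0, i, 0, 0)"] assms
  by (simp add: phi_def MD.alg_form_M MD.bil al_M1 be_M1 iota_zero iota_minus be_zero al_zero)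

lemma cross_al:
  assumes "i \<in> M1" "j \<in> M1"
  shows "sW \<eta> (cr (\<alpha> i) (\<alpha> j)) = \<beta> (cr i j)"
proof -
  have "phi (0, 0, sW 2 (cr i j), 0) =
      alg_triple (Mat 1) \<sigma> (0, 0, \<alpha> i, 0) (0, 0, \<alpha> j, 0) (0, 0, 0, - \<eta>)"
    using phi_triple[of "(0, i, 0, 0)" "(0, j, 0, 0)" "(1, 0, 0, 0)"] assms
    by (simp add: MD.cross_as_triple MD.J_closed)
      (simp add: phi_def iota_zero iota_one be_zero al_zero)
  then have "\<beta> (sW 2 (cr i j)) = sW (2 * \<eta>) (cr (\<alpha> i) (\<alpha> j))"
    using assms by (simp add: MD.cross_as_triple al_M1) (simp add: phi_def)
  then have "sW 2 (\<beta> (cr i j)) = sW 2 (sW \<eta> (cr (\<alpha> i) (\<alpha> j)))"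
    using assms by (simp add: be_scale MD.X_closed iota_two)
  then show ?thesis using two_nonzero_D by (simp only: W.scale_cancel_left) simp
qed

lemma cross_be:
  assumes "i \<in> M1" "j \<in> M1"
  shows "cr (\<beta> i) (\<beta> j) = - sW \<eta> (\<alpha> (cr i j))"
proof -
  have "phi (0, sW (- 2) (cr i j), 0, 0) =
      alg_triple (Mat 1) \<sigma> (0, \<beta> i, 0, 0) (0, \<beta> j, 0, 0) (1 / \<eta>, 0, 0, 0)"
    using phi_triple[of "(0, 0, i, 0)" "(0, 0, j, 0)" "(0, 0, 0, 1)"] assms
    by (simp add: MD.cross_as_triple MD.J_closed)
      (simp add: phi_def iota_zero iota_one be_zero al_zero)
  then have "\<alpha> (sW (- 2) (cr i j)) = sW (2 * (1 / \<eta>)) (cr (\<beta> i) (\<beta> j))"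
    using assms by (simp add: MD.cross_as_triple be_M1 del: W.scale_minus_left) (simp add: phi_def)
  then have "sW 2 (sW (1 / \<eta>) (cr (\<beta> i) (\<beta> j))) = sW 2 (- \<alpha> (cr i j))"
    using assms by (simp add: al_scale MD.X_closed iota_two iota_minus del: W.scale_minus_left) simp
  then have "sW (1 / \<eta>) (cr (\<beta> i) (\<beta> j)) = - \<alpha> (cr i j)"
    using two_nonzero_D by (simp only: W.scale_cancel_left) simp
  then have "sW \<eta> (sW (1 / \<eta>) (cr (\<beta> i) (\<beta> j))) = sW \<eta> (- \<alpha> (cr i j))" by (rule arg_cong)
  then show ?thesis using eta_nonzero by simp
qed

abbreviation "pit \<equiv> pi_tilde \<Omega> C"

lemma pit_eq: "pit (d\<^sub>1, j\<^sub>1, j\<^sub>2, d\<^sub>2) = (\<iota> d\<^sub>2, \<beta> j\<^sub>2, \<alpha> j\<^sub>1, \<iota> d\<^sub>1)"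
  by (simp add: pi_tilde_def)

text \<open>The three compatibilities of \<open>\<alpha>\<close> and \<open>\<beta>\<close> with \<open>T\<close> and \<open>\<times>\<close> are exactly what multiplicativity
  of \<open>\<pi>~\<close> on \<open>M(J,\<eta>)\<close> amounts to.\<close>

lemma pit_mult:
  assumes "x \<in> carr" "y \<in> carr"
  shows "pit (amult (Mat \<eta>) x y) = amult (Mat \<eta>) (pit x) (pit y)"
proof -
  obtain k1 j1 j2 k2 l1 i1 i2 l2 where xy: "x = (k1, j1, j2, k2)" "y = (l1, i1, i2, l2)"
    and J: "j1 \<in> M1" "j2 \<in> M1" "i1 \<in> M1" "i2 \<in> M1"
    using assms by auto
  have T: "T (\<alpha> j) (\<beta> i) = - \<iota> (T j i)" if "i \<in> M1" "j \<in> M1" for i j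
    using that T_be_al[of j i] MD.T_comm[of "\<beta> i" "\<alpha> j"] MD.T_comm[of i j] by (simp add: al_M1 be_M1)
  have sc: "sW \<eta> (cr (\<alpha> i) (\<alpha> j)) = \<beta> (cr i j)" if "i \<in> M1" "j \<in> M1" for i j
    using cross_al that .
  note simps = iota_add iota_mult iota_eta be_add be_scale al_add al_scale MD.J_closed MD.X_closed
  show ?thesis
    unfolding xy MD.amult_M pit_eq using J
    by (simp only: prod.inject sc cross_be T_be_al T simps)
      (simp add: W.scale_minus_left algebra_simps)
qed

lemma amult_carr: "x \<in> carr \<Longrightarrow> y \<in> carr \<Longrightarrow> amult (Mat c) x y \<in> carr"
  by (auto simp: MD.amult_M MD.J_closed MD.X_closed)

section \<open>The operators \<open>V\<close> of \<open>X(\<Omega>,a,\<lambda>)\<close>\<close>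

abbreviation "D\<eta> \<equiv> apfst ((*) \<eta>)"

lemma tau_eq: "tau \<Omega> C x = D\<eta> (mat (inc x))"
  by (simp add: tau_def apfst_def map_prod_def split: prod.splits)

lemma tau_carr: "tau \<Omega> C x \<in> carr"
  using mat_carr[of "inc x"] by (cases "mat (inc x)") (simp add: tau_eq)

lemma inc_add: "inc (x + y) = inc x + inc y" and inc_scale: "inc (sX r x) = sW (E r) (inc x)"
  by (simp_all add: inc_def scaleW_emb)

lemma tau_add: "tau \<Omega> C (x + y) = tau \<Omega> C x + tau \<Omega> C y"
  by (cases "mat (inc x)"; cases "mat (inc y)") (simp add: tau_eq inc_add mat_add ring_distribs add_divide_distrib)

lemma tau_diff: "tau \<Omega> C (x - y) = tau \<Omega> C x - tau \<Omega> C y"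
  using tau_add[of "x - y" y] by (simp add: algebra_simps)

lemma tau_inj: "inj (tau \<Omega> C)"
proof (rule injI)
  fix x y assume "tau \<Omega> C x = tau \<Omega> C y"
  then have "mat (inc x) = mat (inc y)"
    using eta_nonzero by (cases "mat (inc x)"; cases "mat (inc y)") (auto simp: tau_eq)
  then have "asm (mat (inc x)) = asm (mat (inc y))" by (rule arg_cong)
  then show "x = y" by (simp add: asm_mat inc_def)
qed

text \<open>Since \<open>\<iota>(\<eta>) = -\<eta>\<close>, scaling the upper left entry by \<open>\<eta>\<close> turns \<open>phi\<close> into \<open>\<pi>~\<close>.\<close>

lemma pit_D: "pit (D\<eta> w) = D\<eta> (phi w)"
  using eta_nonzero D_nonzero N_nonzero by (cases w) (simp add: pit_eq phi_def iota_mult iota_eta iota_divide iota_N iota_D)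

lemma pit_tau: "pit (tau \<Omega> C x) = tau \<Omega> C x"
  by (simp add: tau_eq pit_D mat_et[symmetric] et_inc)

text \<open>The range of \<open>\<tau>\<close> is the whole fixed point set of \<open>\<pi>~\<close>, and hence is closed under the
  multiplication and the involution; otherwise \<open>the_inv\<close> in the definition of the algebra would
  return an arbitrary value.\<close>

lemma fixed_tau:
  assumes "w \<in> carr" "pit w = w"
  obtains x where "w = tau \<Omega> C x"
proof -
  define w' where "w' = apfst (\<lambda>d. d / \<eta>) w"
  have w: "w = D\<eta> w'" using eta_nonzero by (cases w) (simp add: w'_def)
  have w': "w' \<in> carr" using assms(1) by (auto simp: w'_def)
  have "phi w' = w'"
    using assms(2) eta_nonzero unfolding w pit_D by (cases w'; cases "phi w'") simp
  then have "et (asm w') = asm w'" using et_asm[OF w'] by simp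
  then obtain x where "asm w' = inc x" by (rule et_fixed)
  then have "mat (inc x) = w'" using mat_asm[OF w'] by simp
  then show ?thesis using that[of x] w by (simp add: tau_eq)
qed

abbreviation "XA \<equiv> X_alg \<Omega> C"
abbreviation "\<tau> \<equiv> tau \<Omega> C"

lemma tau_mult: "\<tau> (amult XA x y) = amult (Mat \<eta>) (\<tau> x) (\<tau> y)"
proof -
  obtain u where u: "amult (Mat \<eta>) (\<tau> x) (\<tau> y) = \<tau> u"
    using fixed_tau[OF amult_carr[OF tau_carr tau_carr]]
    by (metis pit_mult[OF tau_carr tau_carr] pit_tau)
  then show ?thesis
    by (simp add: X_alg_def fixed_alg_def Let_def MJ_eq the_inv_f_f[OF tau_inj])
qed

lemma tau_conj: "\<tau> (aconj XA x) = aconj (Mat \<eta>) (\<tau> x)"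
proof -
  obtain d1 j1 j2 d2 where tx: "\<tau> x = (d1, j1, j2, d2)" by (cases "\<tau> x")
  then have "pit (aconj (Mat \<eta>) (\<tau> x)) = aconj (Mat \<eta>) (\<tau> x)"
    using pit_tau[of x] by (simp add: MD.aconj_M pit_eq)
  moreover have "aconj (Mat \<eta>) (\<tau> x) \<in> carr"
    using tau_carr[of x] tx by (simp add: MD.aconj_M)
  ultimately obtain u where u: "aconj (Mat \<eta>) (\<tau> x) = \<tau> u" using fixed_tau by metis
  then show ?thesis
    by (simp add: X_alg_def fixed_alg_def Let_def MJ_eq the_inv_f_f[OF tau_inj])
qed

lemma tau_V: "\<tau> (V_op XA x y z) = V_op (Mat \<eta>) (\<tau> x) (\<tau> y) (\<tau> z)"
  by (simp add: V_op_def tau_add tau_diff tau_mult tau_conj)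

text \<open>The algebra \<open>X(\<Omega>,a,\<lambda>)\<close> is built so that \<open>s\<^sub>0\<close> corresponds to \<open>\<eta>\<^sup>-\<^sup>1 diag(1,-1)\<close>.\<close>

lemma tau_s0: "\<tau> (s0 \<Omega> C) = (1 / \<eta>, 0, 0, - (1 / \<eta>))"
proof -
  let ?a = "inc (pt C)" and ?b = "sW (1 / D) (inc (a_pi_a \<Omega> C))"
  let ?S = "sW (N / (2 * D ^ 2)) (sW (\<iota> l) (?a + ?b) - sW l (- ?a + ?b))"
  let ?w = "(N ^ 2 / D ^ 2, 0, 0, - (N / D)) :: ('d, 'x \<times> 'x) jmat"
  have w: "?w \<in> carr" by (simp add: MD.J_closed)
  have t0: "t 0 = 0" using be_zero et_et[of "t 0"] by (simp add: et_eq zero_prod_def)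
  \<comment> \<open>The defining expression of \<open>s\<^sub>0\<close> is \<open>N(\<lambda>)\<delta>\<^sup>-\<^sup>2 (N(\<lambda>)u\<^sub>1 - \<delta>u\<^sub>2)\<close>.\<close>
  have a: "?a + ?b = sW 2 (u1' \<Omega> C)" and b: "- ?a + ?b = sW (2 * D) (u2' \<Omega> C)"
    using two_nonzero_D D_nonzero by (simp_all add: u1'_def u2'_def)
  have u: "u1' \<Omega> C = sW l (u1 \<Omega> C)" "u2' \<Omega> C = sW (1 / l) (u2 \<Omega> C)"
    using lam_nonzero by (simp_all add: u1_def u2_def)
  have "N / (2 * D\<^sup>2) * (\<iota> l * (2 * l)) = N ^ 2 / D ^ 2"
    using two_nonzero_D D_nonzero by (simp add: N_lam_def power2_eq_square field_simps)
  moreover have "N / (2 * D\<^sup>2) * (l * (2 * D * (1 / l))) = N / D"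
    using two_nonzero_D D_nonzero lam_nonzero by (simp add: power2_eq_square)
  ultimately have S: "?S = asm ?w"
    unfolding a b u by (simp only: W.scale_right_diff_distrib W.scale_scale)
      (simp add: assemble_def t0)
  \<comment> \<open>It is fixed by \<open>et\<close> and therefore lies in \<open>X\<close>.\<close>
  have "phi ?w = ?w"
    using D_nonzero N_nonzero
    by (simp add: phi_def be_zero al_zero iota_divide iota_mult iota_minus iota_N iota_D power2_eq_square)
  then have "et ?S = ?S" unfolding S using et_asm[OF w] by simp
  then obtain x where x: "?S = inc x" by (rule et_fixed)
  have "s0 \<Omega> C = the_inv inc ?S"
    unfolding s0_def Let_def ..
  also have "\<dots> = x"
    unfolding x by (rule the_inv_f_f) (simp add: inj_on_def inc_def)
  finally have "mat (inc (s0 \<Omega> C)) = ?w"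
    using x S mat_asm[OF w] by simp
  then show ?thesis
    using D_nonzero N_nonzero by (simp add: tau_eq power2_eq_square)
qed

lemma V_matrix_rescale:
  assumes "x \<in> carr" "y \<in> carr" "z \<in> carr"
  shows "V_op (Mat \<eta>) (D\<eta> x) (amult (Mat \<eta>) (1 / \<eta>, 0, 0, - (1 / \<eta>)) (D\<eta> y)) (D\<eta> z) =
    D\<eta> (V_op (Mat 1) x (amult (Mat 1) \<sigma> y) z)"
proof -
  obtain k1 j1 j2 k2 l1 i1 i2 l2 m1 n1 n2 m2 where
    xyz: "x = (k1, j1, j2, k2)" "y = (l1, i1, i2, l2)" "z = (m1, n1, n2, m2)"
    and J: "j1 \<in> M1" "j2 \<in> M1" "i1 \<in> M1" "i2 \<in> M1" "n1 \<in> M1" "n2 \<in> M1"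
    using assms by auto
  let ?r = "1 / \<eta>"
  have 1: "amult (Mat \<eta>) (?r, 0, 0, - ?r) (D\<eta> y) = (l1, sW ?r i1, sW (- ?r) i2, - ?r * l2)"
    using J D_nonzero N_nonzero by (simp add: xyz MD.amult_M MD.bil)
  have 2: "amult (Mat 1) \<sigma> y = (l1, sW \<eta> (sW ?r i1), sW \<eta> (sW (- ?r) i2), \<eta> * (- ?r * l2))"
    using J eta_nonzero D_nonzero N_nonzero by (simp add: xyz MD.amult_M MD.bil)
  show ?thesis
    unfolding 1 2 unfolding xyz apfst_conv using J by (intro MD.V_rescale) (simp_all only: MD.J_closed)
qed

lemma scale_double: "ascale (Mat 1) (1 / 2) (ascale (Mat 1) 2 w) = w"
  using two_nonzero_D by (cases w) (simp add: MD.ascale_M)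

text \<open>The operators \<open>V\<close> of \<open>X(\<Omega>,a,\<lambda>)\<close> in terms of \<open>\<Omega>\<close> alone: the choices of \<open>a\<close>, \<open>\<lambda>\<close>, \<open>J\<close> and
  \<open>t\<close> have disappeared.\<close>

lemma V_eq:
  "V_op XA x (amult XA (s0 \<Omega> C) y) z =
    sX (1 / 2) (p x y z + sX (g y z) x + sX (g y x) z + sX (g x z) y)"
proof -
  let ?x = "mat (inc x)" and ?y = "mat (inc y)" and ?z = "mat (inc z)"
  let ?V = "V_op (Mat 1) ?x (amult (Mat 1) \<sigma> ?y) ?z"
  let ?r = "p x y z + sX (g y z) x + sX (g y x) z + sX (g x z) y"
  have "mat (inc (p x y z)) = alg_triple (Mat 1) \<sigma> ?x ?y ?z"
    by (simp add: mat_triple[symmetric] W_triple_inc)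
  then have "ascale (Mat 1) 2 ?V = mat (inc ?r)"
    by (simp add: alg_triple_def inc_add mat_add inc_scale mat_scale mat_form W_form_inc algebra_simps)
  then have "ascale (Mat 1) (1 / 2) (mat (inc ?r)) = ?V"
    by (metis scale_double)
  then have V: "?V = mat (inc (sX (1 / 2) ?r))"
    by (simp add: inc_scale mat_scale emb_divide emb_one emb_two)
  have "\<tau> (V_op XA x (amult XA (s0 \<Omega> C) y) z) = \<tau> (sX (1 / 2) ?r)"
    unfolding tau_V tau_mult tau_s0
    unfolding tau_eq V_matrix_rescale[OF mat_carr mat_carr mat_carr] V ..
  then show ?thesis using tau_inj by (rule injD[rotated])
qed

lemma V_act:
  assumes "v \<noteq> 0"
  shows "ac (V_op XA x (amult XA (s0 \<Omega> C) y) z) v =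
    sX (1 / q v) (V_op XA (ac x v) (amult XA (s0 \<Omega> C) (ac y v)) (ac z v))"
proof -
  let ?r = "\<lambda>x y z. p x y z + sX (g y z) x + sX (g y x) z + sX (g x z) y"
  have "q v \<noteq> 0" using anisotropic assms by blast
  moreover have "?r (ac x v) (ac y v) (ac z v) = sX (q v) (ac (?r x y z) v)"
    by (simp add: X_triple_act[OF char_not_3] gform_act act_add_left act_scale_left X.scale_right_distrib)
  ultimately show ?thesis by (simp add: V_eq act_scale_left mult.commute)
qed

end

theorem corollary5p8:
  fixes \<Omega> :: "('k::field, 'l::ab_group_add, 'x::ab_group_add) quad_alg"
    and C :: "('k, 'x, 'd::field) X_data"
    and x y z :: 'x and v :: 'l
  assumes "quadrangular_algebra \<Omega>"
    and "CHAR('k) \<noteq> 2" and "CHAR('k) \<noteq> 3"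
    and "X_construction \<Omega> C"
    and "v \<noteq> 0"
  shows "act \<Omega> (V_op (X_alg \<Omega> C) x (amult (X_alg \<Omega> C) (s0 \<Omega> C) y) z) v =
    scaleX \<Omega> (1 / qform \<Omega> v)
      (V_op (X_alg \<Omega> C) (act \<Omega> x v) (amult (X_alg \<Omega> C) (s0 \<Omega> C) (act \<Omega> y v)) (act \<Omega> z v))"
  using X_construction.V_act[OF assms(4,5)] .

end
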